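(* Let $G=(\mathbb{Z}_3)^2\rtimes Q_8$, where the quaternion group $Q_8$ of order $8$ acts faithfully on $(\mathbb{Z}_3)^2$. Then the Terwilliger algebra $T(G)$ of the group association scheme of $G$ satisfies $\dim_{\mathbb{C}} T(G)=44$.
   Context: Let $G$ be a finite group with identity $e$ and conjugacy classes $C_0=\{e\},C_1,\dots,C_d$. The group association scheme of $G$ has adjacency matrices $A_0,\dots,A_d$, the $|G|\times|G|$ complex matrices indexed by $G$ with $(A_i)_{xy}=1$ if $yx^{-1}\in C_i$ and $0$ otherwise. For $0\le i\le d$ let $E_i^*$ be the diagonal matrix indexed by $G$ with $(E_i^* )_{yy}=1$ if $y\in C_i$ and $0$ otherwise. The Terwilliger algebra $T(G)$ (base point the identity) is the subalgebra of $M_{|G|}(\mathbb{C})$ generated by $A_0,\dots,A_d,E_0^*,\dots,E_d^*$. The group $(\mathbb{Z}_3)^2\rtimes Q_8=\langle x,y\rangle\rtimes\langle a,b,c\rangle$ is given by the relations $a^2=b^2=c$, $c^2=e$, $x^3=y^3=e$, $xy=yx$, $b^a=bc$, $x^a=xy^2$, $x^b=y$, $x^c=x^2$, $y^a=x^2y^2$, $y^b=x^2$, $y^c=y^2$, where $u^v$ denotes the conjugate of $u$ by $v$; it has order $72$. *)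

theory Defs
  imports "HOL-Algebra.Elementary_Groups" "HOL-Algebra.Group_Action"
    "HOL-Library.Function_Algebras" Complex_Main
begin

section \<open>Complex matrices indexed by the elements of a group\<close>

text \<open>
  A matrix with rows and columns indexed by a set X is a function
  \<^typ>\<open>'g \<Rightarrow> 'g \<Rightarrow> complex\<close> that vanishes outside \<open>X \<times> X\<close>. Addition is the pointwise
  one from \<^theory>\<open>HOL-Library.Function_Algebras\<close>; the pointwise product that theory also
  provides is not used.
\<close>

definition cmat_scale :: "complex \<Rightarrow> ('g \<Rightarrow> 'g \<Rightarrow> complex) \<Rightarrow> ('g \<Rightarrow> 'g \<Rightarrow> complex)" where
  "cmat_scale c M = (\<lambda>x y. c * M x y)"

interpretation cmat: vector_space cmat_scale
  by unfold_locales (auto simp: cmat_scale_def fun_eq_iff algebra_simps)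

definition cmat_mult ::
    "'g set \<Rightarrow> ('g \<Rightarrow> 'g \<Rightarrow> complex) \<Rightarrow> ('g \<Rightarrow> 'g \<Rightarrow> complex) \<Rightarrow> ('g \<Rightarrow> 'g \<Rightarrow> complex)" where
  "cmat_mult X M N = (\<lambda>x z. \<Sum>y\<in>X. M x y * N y z)"

text \<open>
  No identity matrix is demanded here: the identity is the adjacency matrix of the class of the
  neutral element, so in the Terwilliger algebra it is among the generators.
\<close>

definition cmat_subalgebra :: "'g set \<Rightarrow> ('g \<Rightarrow> 'g \<Rightarrow> complex) set \<Rightarrow> bool" where
  "cmat_subalgebra X B \<longleftrightarrow>
     cmat.subspace B \<and> (\<forall>M\<in>B. \<forall>N\<in>B. cmat_mult X M N \<in> B)"

section \<open>The Terwilliger algebra of the group association scheme\<close>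

definition conjugacy_classes :: "('g, 'm) monoid_scheme \<Rightarrow> 'g set set" where
  "conjugacy_classes G =
     orbits G (carrier G) (\<lambda>g. \<lambda>h\<in>carrier G. g \<otimes>\<^bsub>G\<^esub> h \<otimes>\<^bsub>G\<^esub> inv\<^bsub>G\<^esub> g)"

definition adjacency_matrix :: "('g, 'm) monoid_scheme \<Rightarrow> 'g set \<Rightarrow> 'g \<Rightarrow> 'g \<Rightarrow> complex" where
  "adjacency_matrix G C =
     (\<lambda>x y. if x \<in> carrier G \<and> y \<in> carrier G \<and> y \<otimes>\<^bsub>G\<^esub> inv\<^bsub>G\<^esub> x \<in> C then 1 else 0)"

definition dual_idempotent :: "'g set \<Rightarrow> 'g \<Rightarrow> 'g \<Rightarrow> complex" where
  "dual_idempotent C = (\<lambda>x y. if x = y \<and> y \<in> C then 1 else 0)"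

definition terwilliger_algebra ::
    "('g, 'm) monoid_scheme \<Rightarrow> ('g \<Rightarrow> 'g \<Rightarrow> complex) set" where
  "terwilliger_algebra G =
     cmat_subalgebra (carrier G) hull
       (adjacency_matrix G ` conjugacy_classes G \<union> dual_idempotent ` conjugacy_classes G)"

section \<open>The quaternion group and semidirect products\<close>

text \<open>
  The quadruple \<open>(p, q, r, s)\<close> stands for the integral quaternion \<open>p + q i + r j + s k\<close>, and
  the group consists of the units \<open>\<plusminus>1, \<plusminus>i, \<plusminus>j, \<plusminus>k\<close> under the Hamilton product.
\<close>

fun hamilton_mult ::
    "int \<times> int \<times> int \<times> int \<Rightarrow> int \<times> int \<times> int \<times> int \<Rightarrow> int \<times> int \<times> int \<times> int" where
  "hamilton_mult (p, q, r, s) (p', q', r', s') =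
     (p * p' - q * q' - r * r' - s * s',
      p * q' + q * p' + r * s' - s * r',
      p * r' - q * s' + r * p' + s * q',
      p * s' + q * r' - r * q' + s * p')"

definition quaternion_group :: "(int \<times> int \<times> int \<times> int) monoid" where
  "quaternion_group =
     \<lparr>carrier = {(1, 0, 0, 0), (-1, 0, 0, 0), (0, 1, 0, 0), (0, -1, 0, 0),
                 (0, 0, 1, 0), (0, 0, -1, 0), (0, 0, 0, 1), (0, 0, 0, -1)},
      mult = hamilton_mult, one = (1, 0, 0, 0)\<rparr>"

lemma group_quaternion_group: "group quaternion_group"
proof (rule groupI)
  fix x y z
  show "x \<otimes>\<^bsub>quaternion_group\<^esub> y \<otimes>\<^bsub>quaternion_group\<^esub> z =
        x \<otimes>\<^bsub>quaternion_group\<^esub> (y \<otimes>\<^bsub>quaternion_group\<^esub> z)"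
    by (cases x; cases y; cases z) (simp add: quaternion_group_def algebra_simps)
qed (auto simp: quaternion_group_def)

text \<open>
  The group G is the (internal) semidirect product of its normal subgroup N by its subgroup Q,
  which acts on N by conjugation.
\<close>

definition is_semidirect_product :: "('g, 'm) monoid_scheme \<Rightarrow> 'g set \<Rightarrow> 'g set \<Rightarrow> bool" where
  "is_semidirect_product G N Q \<longleftrightarrow>
     N \<lhd> G \<and> subgroup Q G \<and> N \<inter> Q = {\<one>\<^bsub>G\<^esub>} \<and> N <#>\<^bsub>G\<^esub> Q = carrier G"

definition acts_faithfully_by_conjugation ::
    "('g, 'm) monoid_scheme \<Rightarrow> 'g set \<Rightarrow> 'g set \<Rightarrow> bool" where
  "acts_faithfully_by_conjugation G Q N \<longleftrightarrow>
     inj_on (\<lambda>q. \<lambda>n\<in>N. q \<otimes>\<^bsub>G\<^esub> n \<otimes>\<^bsub>G\<^esub> inv\<^bsub>G\<^esub> q) Q"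

end

theory Submission
  imports Defs "HOL-Library.Disjoint_Sets"
begin

text \<open>
  Let z be the involution of Q and let H be the union of N and its coset Nz. Faithfulness forces z
  to invert N. Indeed, the elements of N inverted by z form a subgroup that Q leaves invariant.
  It is not trivial, since n (n^z)^-1 is inverted for every n and z moves some n. It does not have
  order 3, since z is a square in Q and the square of an automorphism of a group of order 3 is the
  identity, which inverts nothing but 1. So it is all of N (\<open>z_inverts\<close>). Every element
  of Q other than 1 and z is a square root of z, so no non-identity element of Q fixes a
  non-identity element of N: the group is a Frobenius group with kernel N. Counting then
  gives the conjugacy classes: {1}, N - {1}, the coset Nz = H - N, and the three
  cosets of H other than H itself (\<open>conj_class_eq_chain_class\<close>).

  For such a group the class of y x^-1 is determined by four data: the classes of x and of y, whether
  x = y, and whether x and y lie in the same coset of N (\<open>pair_type_quotient\<close>). Thus the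
  Terwilliger algebra lies in the space W of all matrices whose entries depend on these data only. The
  space W is spanned by the all-ones matrices on the blocks C \<times> D for classes C and D, and,
  for every class C, the relation "same coset of N" and the identity matrix cut down to C \<times> C.
  In each of these relations from C to D, the number of partners is the same for all points
  of C, and likewise for all points of D. Therefore the product of two of them is zero or a multiple
  of a third (\<open>basic_mult\<close>), and W is an algebra. Conversely the Terwilliger algebra
  contains W: its adjacency matrices add up to the all-ones matrix, those of the two classes inside N
  add up to the relation "same coset of N", and the dual idempotents cut out the blocks.

  The dimension of W is the number of combinations of the four data that occur
  (\<open>dim_span_basic_matrices\<close>). With six classes there are 36 pairs (C, D), each giving
  one combination (for C = D, the pairs x = y). A further one, distinct points in
  the same coset of N, arises in the five classes other than {1}, and yet another, points in
  different cosets of N, in the three classes outside H. This gives 36 + 5 + 3 = 44.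
\<close>

section \<open>Zero-one matrices\<close>

definition rel_matrix :: "'g rel \<Rightarrow> 'g \<Rightarrow> 'g \<Rightarrow> complex" where
  "rel_matrix R x y = of_bool ((x, y) \<in> R)"

lemma rel_matrix_Un_disjoint:
  "R \<inter> S = {} \<Longrightarrow> rel_matrix (R \<union> S) = rel_matrix R + rel_matrix S"
  by (auto simp: rel_matrix_def fun_eq_iff)

lemma rel_matrix_Diff:
  "S \<subseteq> R \<Longrightarrow> rel_matrix (R - S) = rel_matrix R - rel_matrix S"
  by (auto simp: rel_matrix_def fun_eq_iff)

lemma sum_rel_matrix_apply:
  "(\<Sum>i\<in>I. f i) x y = (\<Sum>i\<in>I. (f i x y :: complex))"
  by (induction I rule: infinite_finite_induct) auto

lemma rel_matrix_UN_disjoint: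
  assumes "finite I" "disjoint_family_on R I"
  shows "rel_matrix (\<Union>i\<in>I. R i) = (\<Sum>i\<in>I. rel_matrix (R i))"
  using assms
proof (induction I rule: finite_induct)
  case empty
  show ?case by (auto simp: rel_matrix_def fun_eq_iff)
next
  case (insert i I)
  have "R i \<inter> (\<Union>j\<in>I. R j) = {}"
    using insert.hyps insert.prems unfolding disjoint_family_on_def by auto
  moreover have "disjoint_family_on R I"
    using insert.prems unfolding disjoint_family_on_def by auto
  ultimately show ?case
    using insert by (simp add: rel_matrix_Un_disjoint)
qed

lemma cmat_mult_rel_matrix:
  assumes "finite X"
  shows "cmat_mult X (rel_matrix R) (rel_matrix S) x z
    = of_nat (card {y \<in> X. (x, y) \<in> R \<and> (y, z) \<in> S})"
proof -
  have "cmat_mult X (rel_matrix R) (rel_matrix S) x z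
      = (\<Sum>y\<in>X. of_bool ((x, y) \<in> R \<and> (y, z) \<in> S))"
    unfolding cmat_mult_def rel_matrix_def by (intro sum.cong) auto
  also have "\<dots> = of_nat (card {y \<in> X. (x, y) \<in> R \<and> (y, z) \<in> S})"
    using assms by (simp add: Int_def)
  finally show ?thesis .
qed

lemma cmat_mult_rel_matrix_scale:
  assumes "finite X"
    and "\<And>x z. card {y \<in> X. (x, y) \<in> R \<and> (y, z) \<in> S} = (if (x, z) \<in> U then m else 0)"
  shows "cmat_mult X (rel_matrix R) (rel_matrix S) = cmat_scale (of_nat m) (rel_matrix U)"
  using assms by (simp add: fun_eq_iff cmat_mult_rel_matrix cmat_scale_def rel_matrix_def)

text \<open>
  Multiplication is bilinear, so closure under products needs to be tested on a spanning set only.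
\<close>

lemma cmat_subalgebra_span:
  assumes closed: "\<And>M M'. M \<in> B \<Longrightarrow> M' \<in> B \<Longrightarrow> cmat_mult X M M' \<in> cmat.span B"
  shows "cmat_subalgebra X (cmat.span B)"
proof -
  have left: "cmat_mult X M M' \<in> cmat.span B" if "M \<in> cmat.span B" "M' \<in> B" for M M'
    using that(1)
  proof (induction rule: cmat.span_induct_alt)
    case base
    show ?case using cmat.span_zero by (simp add: cmat_mult_def zero_fun_def)
  next
    case (step c x y)
    have eq: "cmat_mult X (cmat_scale c x + y) M'
        = cmat_scale c (cmat_mult X x M') + cmat_mult X y M'"
      by (simp add: cmat_mult_def cmat_scale_def fun_eq_iff sum_distrib_left
          sum.distrib distrib_right mult.assoc)
    show ?case
      unfolding eq by (intro cmat.span_add cmat.span_scale closed step that)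
  qed
  have "cmat_mult X M M' \<in> cmat.span B"
    if "M \<in> cmat.span B" "M' \<in> cmat.span B" for M M'
    using that(2)
  proof (induction rule: cmat.span_induct_alt)
    case base
    show ?case using cmat.span_zero by (simp add: cmat_mult_def zero_fun_def)
  next
    case (step c x y)
    have eq: "cmat_mult X M (cmat_scale c x + y)
        = cmat_scale c (cmat_mult X M x) + cmat_mult X M y"
      by (simp add: cmat_mult_def cmat_scale_def fun_eq_iff sum_distrib_left
          sum.distrib distrib_left mult.left_commute)
    show ?case
      unfolding eq by (intro cmat.span_add cmat.span_scale left step that)
  qed
  then show ?thesis unfolding cmat_subalgebra_def by (simp add: cmat.subspace_span)
qed

lemma cmat_subalgebra_hull: "cmat_subalgebra X (cmat_subalgebra X hull S)"
  by (rule hull_in) (auto simp: cmat_subalgebra_def intro: cmat.subspace_Inter)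

text \<open>
  The fibres of a map on pairs are disjoint and nonempty, so the coefficient of each of their matrices
  in a linear combination can be read off at a single entry.
\<close>

lemma dim_span_fibres:
  fixes type_of :: "'g \<times> 'g \<Rightarrow> 't"
  assumes "finite A"
  shows "cmat.dim (cmat.span ((\<lambda>t. rel_matrix {p \<in> A. type_of p = t}) ` type_of ` A))
    = card (type_of ` A)"
proof -
  let ?F = "\<lambda>t. rel_matrix {p \<in> A. type_of p = t}"
  have F: "?F t (fst p) (snd p) = of_bool (type_of p = t)" if "p \<in> A" for p t
    using that by (simp add: rel_matrix_def)
  have inj: "inj_on ?F (type_of ` A)"
  proof (rule inj_onI)
    fix s t assume "s \<in> type_of ` A" and eq: "?F s = ?F t"
    then obtain p where p: "p \<in> A" "type_of p = s" by auto
    have "?F s (fst p) (snd p) = ?F t (fst p) (snd p)" using eq by simp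
    then show "s = t" using p unfolding F[OF p(1)] by (simp split: if_splits)
  qed
  have "cmat.independent (?F ` type_of ` A)"
  proof (rule cmat.independent_if_scalars_zero)
    fix c M assume 0: "(\<Sum>M\<in>?F ` type_of ` A. cmat_scale (c M) M) = 0" and "M \<in> ?F ` type_of ` A"
    then obtain p where p: "p \<in> A" "M = ?F (type_of p)" by blast
    have "(\<Sum>M\<in>?F ` type_of ` A. cmat_scale (c M) M) (fst p) (snd p)
        = (\<Sum>t\<in>type_of ` A. c (?F t) * of_bool (type_of p = t))"
      by (simp only: sum_rel_matrix_apply cmat_scale_def sum.reindex[OF inj] o_def F[OF p(1)])
    also have "\<dots> = c M"
      using assms p by (subst sum.mono_neutral_right[where S = "{type_of p}"]) auto
    finally show "c M = 0" using 0 by simp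
  qed (use assms in auto)
  from cmat.dim_span_eq_card_independent[OF this] card_image[OF inj] show ?thesis
    by (rule trans)
qed

text \<open>
  A relation that respects the map is a disjoint union of fibres.
\<close>

lemma saturated_rel_matrix_in_span_fibres:
  fixes type_of :: "'g \<times> 'g \<Rightarrow> 't"
  assumes "finite A" "R \<subseteq> A"
    and sat: "\<And>p q. p \<in> R \<Longrightarrow> q \<in> A \<Longrightarrow> type_of p = type_of q \<Longrightarrow> q \<in> R"
  shows "rel_matrix R
    \<in> cmat.span ((\<lambda>t. rel_matrix {p \<in> A. type_of p = t}) ` type_of ` A)"
proof -
  have R: "R = (\<Union>t\<in>type_of ` R. {p \<in> A. type_of p = t})"
  proof (intro equalityI subsetI)
    fix p assume "p \<in> (\<Union>t\<in>type_of ` R. {p \<in> A. type_of p = t})"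
    then obtain q where "q \<in> R" "p \<in> A" "type_of q = type_of p" by auto
    then show "p \<in> R" using sat by blast
  qed (use assms(2) in auto)
  have "finite (type_of ` R)" using assms(1,2) finite_subset by blast
  then have "rel_matrix R = (\<Sum>t\<in>type_of ` R. rel_matrix {p \<in> A. type_of p = t})"
    by (subst (1) R, intro rel_matrix_UN_disjoint) (auto simp: disjoint_family_on_def)
  also have "\<dots> \<in> cmat.span ((\<lambda>t. rel_matrix {p \<in> A. type_of p = t}) ` type_of ` A)"
    using assms(2) by (intro cmat.span_sum cmat.span_base) auto
  finally show ?thesis .
qed

section \<open>Partitions refined by an equivalence relation\<close>

text \<open>
  This isolates what makes the span of the block matrices an algebra. The sets \<open>cls x\<close> partition
  X, and \<open>near\<close> is an equivalence relation that meets each part uniformly. The last assumption says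
  that \<open>near\<close> holds either for all or for no pairs between two different parts, so that it only
  subdivides the diagonal blocks.
\<close>

locale refined_partition =
  fixes X :: "'g set" and cls :: "'g \<Rightarrow> 'g set" and near :: "'g rel"
  assumes finite_X: "finite X"
    and self_in_cls: "x \<in> X \<Longrightarrow> x \<in> cls x"
    and cls_subset: "x \<in> X \<Longrightarrow> cls x \<subseteq> X"
    and cls_eq: "x \<in> X \<Longrightarrow> y \<in> cls x \<Longrightarrow> cls y = cls x"
    and equiv_near: "equiv X near"
    and near_uniform: "x \<in> X \<Longrightarrow> y \<in> cls x \<Longrightarrow>
      card (cls x \<inter> near `` {y}) = card (cls x \<inter> near `` {x})"
    and near_across: "x \<in> X \<Longrightarrow> y \<in> X \<Longrightarrow> cls x \<noteq> cls y \<Longrightarrow> (x, y) \<in> near \<Longrightarrow>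
      x' \<in> cls x \<Longrightarrow> y' \<in> cls y \<Longrightarrow> (x', y') \<in> near"
begin

abbreviation parts :: "'g set set" where
  "parts \<equiv> cls ` X"

definition basic :: "'g set \<Rightarrow> 'g set \<Rightarrow> 'g rel \<Rightarrow> bool" where
  "basic C D R \<longleftrightarrow> R = C \<times> D \<or> C = D \<and> (R = near \<inter> C \<times> C \<or> R = Id_on C)"

definition basic_matrices :: "('g \<Rightarrow> 'g \<Rightarrow> complex) set" where
  "basic_matrices = {rel_matrix R |R C D. C \<in> parts \<and> D \<in> parts \<and> basic C D R}"

text \<open>
  These are the data on which the entries of a matrix in the span may depend.
\<close>

definition pair_type :: "'g \<times> 'g \<Rightarrow> 'g set \<times> 'g set \<times> bool \<times> bool" where
  "pair_type p = (cls (fst p), cls (snd p), fst p = snd p, p \<in> near)"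

lemma part_eq_cls: "C \<in> parts \<Longrightarrow> x \<in> C \<Longrightarrow> cls x = C"
  using cls_eq by blast

lemma part_subset: "C \<in> parts \<Longrightarrow> C \<subseteq> X"
  using cls_subset by blast

lemma parts_disjoint: "C \<in> parts \<Longrightarrow> D \<in> parts \<Longrightarrow> x \<in> C \<Longrightarrow> x \<in> D \<Longrightarrow> C = D"
  using part_eq_cls by blast

lemma mem_part_iff: "C \<in> parts \<Longrightarrow> x \<in> X \<Longrightarrow> x \<in> C \<longleftrightarrow> cls x = C"
  using self_in_cls part_eq_cls by blast

lemma basic_subset: "basic C D R \<Longrightarrow> R \<subseteq> C \<times> D"
  by (auto simp: basic_def)

lemma near_sym: "(x, y) \<in> near \<Longrightarrow> (y, x) \<in> near"
  using equiv_near by (meson equivE symE)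

lemma near_trans: "(x, y) \<in> near \<Longrightarrow> (y, w) \<in> near \<Longrightarrow> (x, w) \<in> near"
  using equiv_near by (meson equivE transE)

lemma near_refl: "x \<in> X \<Longrightarrow> (x, x) \<in> near"
  using equiv_near by (meson equivE refl_onD)

lemma near_across_iff:
  assumes "x \<in> X" "y \<in> X" "cls x \<noteq> cls y" "x' \<in> cls x" "y' \<in> cls y"
  shows "(x', y') \<in> near \<longleftrightarrow> (x, y) \<in> near"
proof
  assume "(x', y') \<in> near"
  moreover have "x' \<in> X" "y' \<in> X" "cls x' = cls x" "cls y' = cls y" "x \<in> cls x" "y \<in> cls y"
    using assms cls_subset cls_eq self_in_cls by blast+
  ultimately show "(x, y) \<in> near" using assms(3) near_across[of x' y' x y] by metis
qed (use assms near_across in blast)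

lemma near_part_card:
  assumes "C \<in> parts"
  obtains m where "\<And>x. x \<in> C \<Longrightarrow> card (C \<inter> near `` {x}) = m"
  using assms near_uniform by blast

text \<open>
  Constancy of the degrees is what turns a product of two basic matrices into a multiple of a single
  matrix: an entry of the product counts the points joining a row to a column.
\<close>

lemma basic_out_degree:
  assumes "C \<in> parts" "basic C D R"
  obtains m where "\<And>x. x \<in> C \<Longrightarrow> card {y \<in> D. (x, y) \<in> R} = m"
proof -
  obtain m where m: "\<And>x. x \<in> C \<Longrightarrow> card (C \<inter> near `` {x}) = m"
    using near_part_card assms(1) by blast
  have *: "{y \<in> C. (x, y) \<in> near \<inter> C \<times> C} = C \<inter> near `` {x}"
    "{y \<in> C. (x, y) \<in> Id_on C} = {x}" "{y \<in> D. (x, y) \<in> C \<times> D} = D" if "x \<in> C" for x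
    using that by auto
  from assms(2) consider "R = C \<times> D" | "C = D" "R = near \<inter> C \<times> C" | "C = D" "R = Id_on C"
    by (auto simp: basic_def)
  then show ?thesis
    by cases (use * m that in \<open>fastforce+\<close>)
qed

lemma basic_converse: "basic C D R \<Longrightarrow> basic D C (R\<inverse>)"
  using near_sym by (auto simp: basic_def)

lemma basic_in_degree:
  assumes "D \<in> parts" "basic C D R"
  obtains m where "\<And>y. y \<in> D \<Longrightarrow> card {x \<in> C. (x, y) \<in> R} = m"
  using basic_out_degree[OF assms(1) basic_converse[OF assms(2)]] by auto

text \<open>
  If one factor is a full block, the joining points are counted by the degrees of the other, and the
  product is a multiple of a full block. Otherwise both factors live on the same diagonal block, and
  either one is an identity or both are \<open>near\<close>, where transitivity makes the joining points of a
  related pair exactly the common \<open>near\<close>-class within the part.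
\<close>

lemma basic_mult:
  assumes parts: "C \<in> parts" "D \<in> parts" "F \<in> parts"
    and R: "basic C D R" and S: "basic D F S"
  shows "\<exists>m U. basic C F U \<and>
    cmat_mult X (rel_matrix R) (rel_matrix S) = cmat_scale (of_nat m) (rel_matrix U)"
proof -
  have cut: "{y \<in> X. (x, y) \<in> R \<and> (y, w) \<in> S} = {y \<in> D. (x, y) \<in> R \<and> (y, w) \<in> S}" for x w
    using basic_subset[OF R] part_subset[OF parts(2)] by auto
  have ?thesis if "basic C F U"
    and "\<And>x w. card {y \<in> D. (x, y) \<in> R \<and> (y, w) \<in> S} = (if (x, w) \<in> U then m else 0)" for U m
    using that cmat_mult_rel_matrix_scale[OF finite_X, of R S U m] cut by auto
  note by_counting = this
  from R S consider "R = C \<times> D" | "S = D \<times> F"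
    | "C = D" "R = Id_on C" | "D = F" "S = Id_on D"
    | "C = D" "D = F" "R = near \<inter> C \<times> C" "S = near \<inter> C \<times> C"
    unfolding basic_def by blast
  then show ?thesis
  proof cases
    case 1
    obtain m where m: "\<And>w. w \<in> F \<Longrightarrow> card {y \<in> D. (y, w) \<in> S} = m"
      using basic_in_degree[OF parts(3) S] by blast
    have "{y \<in> D. (x, y) \<in> R \<and> (y, w) \<in> S} = (if (x, w) \<in> C \<times> F then {y \<in> D. (y, w) \<in> S} else {})"
      for x w using 1 basic_subset[OF S] by auto
    then show ?thesis by (intro by_counting[of "C \<times> F" m]) (auto simp: basic_def m)
  next
    case 2
    obtain m where m: "\<And>x. x \<in> C \<Longrightarrow> card {y \<in> D. (x, y) \<in> R} = m"
      using basic_out_degree[OF parts(1) R] by blast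
    have "{y \<in> D. (x, y) \<in> R \<and> (y, w) \<in> S} = (if (x, w) \<in> C \<times> F then {y \<in> D. (x, y) \<in> R} else {})"
      for x w using 2 basic_subset[OF R] by auto
    then show ?thesis by (intro by_counting[of "C \<times> F" m]) (auto simp: basic_def m)
  next
    case 3
    have "{y \<in> D. (x, y) \<in> R \<and> (y, w) \<in> S} = (if (x, w) \<in> S then {x} else {})" for x w
      using 3 basic_subset[OF S] by auto
    then show ?thesis using S 3 by (intro by_counting[of S 1]) auto
  next
    case 4
    have "{y \<in> D. (x, y) \<in> R \<and> (y, w) \<in> S} = (if (x, w) \<in> R then {w} else {})" for x w
      using 4 basic_subset[OF R] by auto
    then show ?thesis using R 4 by (intro by_counting[of R 1]) auto
  next
    case 5
    obtain m where m: "\<And>x. x \<in> C \<Longrightarrow> card (C \<inter> near `` {x}) = m"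
      using near_part_card parts(1) by blast
    have "{y \<in> D. (x, y) \<in> R \<and> (y, w) \<in> S} = (if (x, w) \<in> R then C \<inter> near `` {x} else {})" for x w
      using 5 by (auto intro: near_trans near_sym)
    then show ?thesis using R 5 m by (intro by_counting[of R m]) auto
  qed
qed

lemma basic_mult_zero:
  assumes "C \<in> parts" "D \<in> parts" "D' \<in> parts" "basic C D R" "basic D' F S" "D \<noteq> D'"
  shows "cmat_mult X (rel_matrix R) (rel_matrix S) = 0"
proof -
  have "{y \<in> X. (x, y) \<in> R \<and> (y, w) \<in> S} = {}" for x w
    using assms parts_disjoint[of D D'] basic_subset[of C D R] basic_subset[of D' F S] by blast
  then show ?thesis
    by (simp only: fun_eq_iff cmat_mult_rel_matrix[OF finite_X] card.empty of_nat_0 zero_fun_apply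
        simp_thms)
qed

lemma subalgebra_span_basic_matrices: "cmat_subalgebra X (cmat.span basic_matrices)"
proof (rule cmat_subalgebra_span)
  fix M M' assume "M \<in> basic_matrices" "M' \<in> basic_matrices"
  then obtain R S C D D' F where
    M: "M = rel_matrix R" "C \<in> parts" "D \<in> parts" "basic C D R" and
    M': "M' = rel_matrix S" "D' \<in> parts" "F \<in> parts" "basic D' F S"
    unfolding basic_matrices_def by blast
  show "cmat_mult X M M' \<in> cmat.span basic_matrices"
  proof (cases "D = D'")
    case True
    then obtain m U where "basic C F U" "cmat_mult X M M' = cmat_scale (of_nat m) (rel_matrix U)"
      using basic_mult M M' by metis
    moreover have "rel_matrix U \<in> basic_matrices"
      using \<open>basic C F U\<close> M M' unfolding basic_matrices_def by blast
    ultimately show ?thesis by (simp add: cmat.span_base cmat.span_scale)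
  next
    case False
    then show ?thesis using basic_mult_zero M M' cmat.span_zero by metis
  qed
qed

text \<open>
  The fibres of \<open>pair_type\<close> are the off-diagonal blocks, the identities of the parts, and the
  differences between consecutive members of the chain identity, \<open>near\<close>, full block on a
  diagonal block.
\<close>

lemma pair_type_fibre_in_span:
  assumes "p \<in> X \<times> X"
  shows "rel_matrix {q \<in> X \<times> X. pair_type q = pair_type p} \<in> cmat.span basic_matrices"
proof -
  obtain x y where p: "p = (x, y)" "x \<in> X" "y \<in> X" using assms by auto
  let ?C = "cls x" and ?D = "cls y"
  have basic_in: "rel_matrix R \<in> cmat.span basic_matrices" if "basic ?C ?D R" for R
  proof (rule cmat.span_base)
    show "rel_matrix R \<in> basic_matrices"
      using that p(2,3) unfolding basic_matrices_def by blast
  qed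
  have fibre: "{q \<in> X \<times> X. pair_type q = pair_type p}
      = {(x', y'). x' \<in> ?C \<and> y' \<in> ?D \<and> (x' = y' \<longleftrightarrow> x = y) \<and> ((x', y') \<in> near \<longleftrightarrow> (x, y) \<in> near)}"
  proof -
    have "x' \<in> X \<and> cls x' = cls x \<longleftrightarrow> x' \<in> ?C" "x' \<in> X \<and> cls x' = cls y \<longleftrightarrow> x' \<in> ?D" for x'
      using p mem_part_iff[of ?C x'] mem_part_iff[of ?D x'] cls_subset by blast+
    then show ?thesis
      unfolding pair_type_def p set_eq_iff by (simp add: split_paired_all) blast
  qed
  have refl: "(w, w) \<in> near" if "w \<in> ?C" for w
    using that near_refl cls_subset[OF p(2)] by blast
  have diag: "Id_on ?C \<subseteq> near \<inter> ?C \<times> ?C"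
    using refl by (auto simp: Id_on_def)
  consider "?C \<noteq> ?D" | "x = y" | "?C = ?D" "x \<noteq> y" "(x, y) \<in> near" | "?C = ?D" "(x, y) \<notin> near"
    by auto
  then show ?thesis
  proof cases
    case 1
    have "{q \<in> X \<times> X. pair_type q = pair_type p} = ?C \<times> ?D"
    proof -
      have "x' \<noteq> y'" if "x' \<in> ?C" "y' \<in> ?D" for x' y'
        using that 1 cls_eq[OF p(2), of x'] cls_eq[OF p(3), of y'] by auto
      moreover have "x \<noteq> y" using 1 by auto
      ultimately show ?thesis
        unfolding fibre set_eq_iff using near_across_iff[OF p(2,3) 1]
        by (simp add: split_paired_all) blast
    qed
    then show ?thesis by (simp add: basic_in basic_def)
  next
    case 2
    have "(x, y) \<in> near" "?C = ?D" using 2 refl self_in_cls[OF p(2)] by auto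
    then have "{q \<in> X \<times> X. pair_type q = pair_type p} = Id_on ?C"
      unfolding fibre using 2 diag by (auto simp: Id_on_def)
    then show ?thesis using 2 by (simp add: basic_in basic_def)
  next
    case 3
    then have eq: "{q \<in> X \<times> X. pair_type q = pair_type p} = near \<inter> ?C \<times> ?C - Id_on ?C"
      unfolding fibre by auto
    show ?thesis
      unfolding eq rel_matrix_Diff[OF diag]
      by (intro cmat.span_diff basic_in) (simp_all add: basic_def 3)
  next
    case 4
    then have eq: "{q \<in> X \<times> X. pair_type q = pair_type p} = ?C \<times> ?C - near \<inter> ?C \<times> ?C"
      unfolding fibre using refl[OF self_in_cls[OF p(2)]] refl by auto
    have sub: "near \<inter> ?C \<times> ?C \<subseteq> ?C \<times> ?C" by auto
    show ?thesis
      unfolding eq rel_matrix_Diff[OF sub]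
      by (intro cmat.span_diff basic_in) (simp_all add: basic_def 4)
  qed
qed

lemma span_basic_matrices_eq_fibres:
  "cmat.span basic_matrices = cmat.span
     ((\<lambda>t. rel_matrix {p \<in> X \<times> X. pair_type p = t}) ` pair_type ` (X \<times> X))" (is "_ = ?S")
proof
  have "rel_matrix R \<in> ?S" if "C \<in> parts" "D \<in> parts" "basic C D R" for C D R
  proof (rule saturated_rel_matrix_in_span_fibres)
    show "R \<subseteq> X \<times> X" using that basic_subset part_subset by blast
    fix p q assume pq: "p \<in> R" "q \<in> X \<times> X" "pair_type p = pair_type q"
    obtain x y where p: "p = (x, y)" by (rule prod.exhaust)
    obtain x' y' where q: "q = (x', y')" by (rule prod.exhaust)
    note xy = p q
    have "x \<in> C" "y \<in> D" using pq(1) basic_subset[OF that(3)] xy by blast+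
    then have "cls x = C" "cls y = D" using that part_eq_cls by blast+
    moreover have "cls x = cls x'" "cls y = cls y'" "x' \<in> X" "y' \<in> X"
      using pq(2,3) unfolding xy pair_type_def fst_conv snd_conv prod.inject mem_Times_iff by blast+
    ultimately have "cls x' = C" "cls y' = D" "x' \<in> X" "y' \<in> X" by (simp_all only:)
    then have "x' \<in> C" "y' \<in> D" using self_in_cls by blast+
    moreover have "x = y \<longleftrightarrow> x' = y'" "(x, y) \<in> near \<longleftrightarrow> (x', y') \<in> near"
      using pq(3) unfolding xy pair_type_def fst_conv snd_conv prod.inject by blast+
    ultimately show "q \<in> R"
      using that(3) pq(1) unfolding basic_def xy by blast
  qed (simp add: finite_X)
  then have "basic_matrices \<subseteq> ?S"
    unfolding basic_matrices_def by (intro subsetI) (elim CollectE exE conjE, simp only:)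
  then show "cmat.span basic_matrices \<subseteq> ?S"
    by (rule cmat.span_minimal[OF _ cmat.subspace_span])
next
  have "(\<lambda>t. rel_matrix {p \<in> X \<times> X. pair_type p = t}) ` pair_type ` (X \<times> X)
      \<subseteq> cmat.span basic_matrices"
    using pair_type_fibre_in_span by (intro subsetI) (elim imageE, simp only:)
  then show "?S \<subseteq> cmat.span basic_matrices"
    by (rule cmat.span_minimal[OF _ cmat.subspace_span])
qed

lemma saturated_in_span_basic_matrices:
  assumes "R \<subseteq> X \<times> X"
    and "\<And>p q. p \<in> R \<Longrightarrow> q \<in> X \<times> X \<Longrightarrow> pair_type p = pair_type q \<Longrightarrow> q \<in> R"
  shows "rel_matrix R \<in> cmat.span basic_matrices"
  unfolding span_basic_matrices_eq_fibres
proof (rule saturated_rel_matrix_in_span_fibres)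
  show "finite (X \<times> X)" by (simp add: finite_X)
qed (fact assms)+

text \<open>
  The first summand counts one type for each pair of parts, the identity standing for a diagonal
  block. The other two count the diagonal blocks that contain distinct near points, and those
  that contain points which are not near.
\<close>

lemma dim_span_basic_matrices:
  "cmat.dim (cmat.span basic_matrices) = card parts ^ 2
     + card {C \<in> parts. \<exists>x\<in>C. \<exists>y\<in>C. x \<noteq> y \<and> (x, y) \<in> near}
     + card {C \<in> parts. \<exists>x\<in>C. \<exists>y\<in>C. (x, y) \<notin> near}"
proof -
  let ?near = "{C \<in> parts. \<exists>x\<in>C. \<exists>y\<in>C. x \<noteq> y \<and> (x, y) \<in> near}"
  let ?far = "{C \<in> parts. \<exists>x\<in>C. \<exists>y\<in>C. (x, y) \<notin> near}"
  \<comment> \<open>The off-diagonal types and the identities, then distinct near pairs, then pairs that are not near.\<close>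
  define off where "off = (\<lambda>(C, D). (C, D, C = D, C = D \<or> (\<exists>x\<in>C. \<exists>y\<in>D. (x, y) \<in> near)))"
  define nr where "nr = (\<lambda>C :: 'g set. (C, C, False, True))"
  define fr where "fr = (\<lambda>C :: 'g set. (C, C, False, False))"
  have "pair_type ` (X \<times> X) = off ` (parts \<times> parts) \<union> nr ` ?near \<union> fr ` ?far"
  proof (intro equalityI subsetI)
    fix t assume "t \<in> pair_type ` (X \<times> X)"
    then obtain x y where xy: "x \<in> X" "y \<in> X" "t = pair_type (x, y)" by auto
    consider "cls x \<noteq> cls y \<or> x = y" | "cls x = cls y" "x \<noteq> y" "(x, y) \<in> near"
      | "cls x = cls y" "(x, y) \<notin> near" by auto
    then show "t \<in> off ` (parts \<times> parts) \<union> nr ` ?near \<union> fr ` ?far"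
    proof cases
      case 1
      have "t = off (cls x, cls y)"
      proof (cases "x = y")
        case True
        then show ?thesis using xy near_refl by (simp add: off_def pair_type_def)
      next
        case False
        with 1 have ne: "cls x \<noteq> cls y" by simp
        have "(\<exists>x'\<in>cls x. \<exists>y'\<in>cls y. (x', y') \<in> near) \<longleftrightarrow> (x, y) \<in> near"
          using near_across_iff[OF xy(1,2) ne] self_in_cls xy(1,2) by blast
        then show ?thesis
          using xy(3) ne False by (simp add: off_def pair_type_def)
      qed
      then show ?thesis using xy by auto
    next
      case 2
      then have "t = nr (cls x)" "cls x \<in> ?near"
        using xy self_in_cls[of x] self_in_cls[of y] by (auto simp: nr_def pair_type_def)
      then show ?thesis by blast
    next
      case 3
      then have "t = fr (cls x)" "cls x \<in> ?far"
        using xy self_in_cls[of x] self_in_cls[of y] near_refl[of x]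
        by (auto simp: fr_def pair_type_def)
      then show ?thesis by blast
    qed
  next
    fix t assume "t \<in> off ` (parts \<times> parts) \<union> nr ` ?near \<union> fr ` ?far"
    then consider (off) x y where "x \<in> X" "y \<in> X" "t = off (cls x, cls y)"
      | (nr) C where "t = nr C" "C \<in> ?near" | (fr) C where "t = fr C" "C \<in> ?far"
      by (elim UnE imageE SigmaE) blast+
    then show "t \<in> pair_type ` (X \<times> X)"
    proof cases
      case off
      show ?thesis
      proof (cases "cls x = cls y")
        case True
        then have "t = pair_type (x, x)" using off near_refl by (simp add: off_def pair_type_def)
        then show ?thesis using off by blast
      next
        case False
        have "(\<exists>x'\<in>cls x. \<exists>y'\<in>cls y. (x', y') \<in> near) \<longleftrightarrow> (x, y) \<in> near"
          using near_across_iff[OF off(1,2) False] self_in_cls off(1,2) by blast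
        moreover have "x \<noteq> y" using False by auto
        ultimately have "t = pair_type (x, y)"
          using off(3) False by (simp add: off_def pair_type_def)
        then show ?thesis using off by blast
      qed
    next
      case nr
      then obtain x y where "x \<in> C" "y \<in> C" "x \<noteq> y" "(x, y) \<in> near" by blast
      moreover have "cls x = C" "cls y = C" "x \<in> X" "y \<in> X"
        using nr(2) part_eq_cls part_subset calculation(1,2) by blast+
      ultimately have "t = pair_type (x, y)" "x \<in> X" "y \<in> X"
        using nr(1) by (simp_all add: nr_def pair_type_def)
      then show ?thesis by blast
    next
      case fr
      then obtain x y where "x \<in> C" "y \<in> C" "(x, y) \<notin> near" by blast
      moreover have "cls x = C" "cls y = C" "x \<in> X" "y \<in> X"
        using fr(2) part_eq_cls part_subset calculation(1,2) by blast+
      moreover have "x \<noteq> y" using near_refl calculation by blast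
      ultimately have "t = pair_type (x, y)" "x \<in> X" "y \<in> X"
        using fr(1) by (simp_all add: fr_def pair_type_def)
      then show ?thesis by blast
    qed
  qed
  moreover have "card (off ` (parts \<times> parts) \<union> nr ` ?near \<union> fr ` ?far)
      = card (off ` (parts \<times> parts)) + card (nr ` ?near) + card (fr ` ?far)"
    using finite_X
    by (subst card_Un_disjoint; (subst card_Un_disjoint)?) (auto simp: off_def nr_def fr_def)
  moreover have "card (off ` (parts \<times> parts)) = card parts ^ 2"
    by (subst card_image) (auto simp: inj_on_def off_def card_cartesian_product power2_eq_square)
  moreover have "card (nr ` ?near) = card ?near" "card (fr ` ?far) = card ?far"
    by (auto intro!: card_image simp: inj_on_def nr_def fr_def)
  moreover have "cmat.dim (cmat.span basic_matrices) = card (pair_type ` (X \<times> X))"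
    unfolding span_basic_matrices_eq_fibres by (rule dim_span_fibres) (simp add: finite_X)
  ultimately show ?thesis by (simp only:)
qed

end

section \<open>Groups whose classes are the layers of a chain\<close>

text \<open>
  The layer containing x in the chain 1, N, H, G, except that outside H the layers are the individual
  cosets of H.
\<close>

definition chain_class :: "('g, 'm) monoid_scheme \<Rightarrow> 'g set \<Rightarrow> 'g set \<Rightarrow> 'g \<Rightarrow> 'g set" where
  "chain_class G N H x =
     (if x = \<one>\<^bsub>G\<^esub> then {\<one>\<^bsub>G\<^esub>} else if x \<in> N then N - {\<one>\<^bsub>G\<^esub>} else if x \<in> H then H - N else H #>\<^bsub>G\<^esub> x)"

definition same_coset :: "('g, 'm) monoid_scheme \<Rightarrow> 'g set \<Rightarrow> 'g rel" where
  "same_coset G N = {(x, y). x \<in> carrier G \<and> y \<in> carrier G \<and> N #>\<^bsub>G\<^esub> x = N #>\<^bsub>G\<^esub> y}"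

text \<open>
  The groups considered here are those in which every layer is a single conjugacy class. That H - N
  consists of one coset of N keeps this layer from being split by the relation of lying in the same
  coset of N; the bound on the order of N makes N - {1} contain two distinct elements.
\<close>

locale class_chain = group G for G (structure) +
  fixes N H :: "'a set" and z :: 'a
  assumes finite_carrier: "finite (carrier G)"
    and normal_N: "N \<lhd> G" and normal_H: "H \<lhd> G"
    and z_carrier: "z \<in> carrier G" and z_notin_N: "z \<notin> N"
    and H_eq: "H = N \<union> (N #> z)"
    and card_N: "card N \<ge> 3"
    and orbit_eq: "x \<in> carrier G \<Longrightarrow>
      orbit G (\<lambda>g. \<lambda>h\<in>carrier G. g \<otimes> h \<otimes> inv g) x = chain_class G N H x"
begin

abbreviation cls :: "'a \<Rightarrow> 'a set" where
  "cls \<equiv> chain_class G N H"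

abbreviation near :: "'a rel" where
  "near \<equiv> same_coset G N"

lemma subgroup_N: "subgroup N G" and subgroup_H: "subgroup H G"
  using normal_N normal_H by (simp_all add: normal_imp_subgroup)

lemma one_in_N: "\<one> \<in> N"
  using subgroup_N by (rule subgroup.one_closed)

lemma N_subset_H: "N \<subseteq> H"
  using H_eq by blast

lemma N_subset: "N \<subseteq> carrier G" and H_subset: "H \<subseteq> carrier G"
  using subgroup_N subgroup_H by (simp_all add: subgroup.subset)

lemma mem_coset_iff:
  assumes "subgroup K G" "x \<in> carrier G" "y \<in> carrier G"
  shows "y \<in> K #> x \<longleftrightarrow> K #> x = K #> y"
proof
  assume "y \<in> K #> x"
  then show "K #> x = K #> y" using assms repr_independence by metis
next
  assume "K #> x = K #> y"
  then show "y \<in> K #> x" using rcos_self[OF assms(3,1)] by simp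
qed

lemma coset_eq_self_iff:
  assumes "subgroup K G" "x \<in> carrier G"
  shows "K #> x = K \<longleftrightarrow> x \<in> K"
  using assms coset_join1 coset_join2 subgroup.subset by metis

lemma H_minus_N_eq_coset: "H - N = N #> z"
proof -
  have "N \<inter> (N #> z) = {}"
  proof (rule ccontr)
    assume "N \<inter> (N #> z) \<noteq> {}"
    then obtain y where "y \<in> N" "y \<in> N #> z" by blast
    then have "N #> z = N #> y" "N #> y = N"
      using mem_coset_iff[OF subgroup_N z_carrier, of y] coset_eq_self_iff[OF subgroup_N, of y]
        N_subset by blast+
    then show False using coset_eq_self_iff[OF subgroup_N z_carrier] z_notin_N by simp
  qed
  then show ?thesis using H_eq by blast
qed

lemma same_coset_iff:
  "(x, y) \<in> near \<longleftrightarrow> x \<in> carrier G \<and> y \<in> carrier G \<and> y \<otimes> inv x \<in> N"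
  using mem_coset_iff[OF subgroup_N] subgroup.rcos_module[OF subgroup_N group_axioms]
  unfolding same_coset_def by blast

lemma near_image: "x \<in> carrier G \<Longrightarrow> near `` {x} = N #> x"
  using mem_coset_iff[OF subgroup_N] r_coset_subset_G[OF N_subset]
  unfolding same_coset_def by blast

lemma cls_subset_coset: "x \<in> carrier G \<Longrightarrow> cls x \<subseteq> H #> x"
  using coset_eq_self_iff[OF subgroup_H] one_in_N N_subset_H rcos_self[OF _ subgroup_H]
  by (auto simp: chain_class_def)

lemma cls_simps:
  "cls \<one> = {\<one>}"
  "x \<in> N \<Longrightarrow> x \<noteq> \<one> \<Longrightarrow> cls x = N - {\<one>}"
  "x \<in> H \<Longrightarrow> x \<notin> N \<Longrightarrow> cls x = H - N"
  "x \<notin> H \<Longrightarrow> cls x = H #> x"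
  using one_in_N N_subset_H by (auto simp: chain_class_def)

lemma cls_cases:
  obtains "x = \<one>" | "x \<in> N" "x \<noteq> \<one>" | "x \<in> H" "x \<notin> N" | "x \<notin> H"
  by blast

text \<open>
  Outside N each class is a union of cosets of N, so a coset of N can meet two classes only inside N.
\<close>

lemma near_different_class:
  assumes "(x, y) \<in> near" "cls x \<noteq> cls y"
  shows "x \<in> N \<and> y \<in> N"
proof -
  have xy: "x \<in> carrier G" "y \<in> carrier G" "N #> x = N #> y"
    using assms(1) by (auto simp: same_coset_def)
  have "y \<in> N #> x" using xy mem_coset_iff[OF subgroup_N] by blast
  then have "y \<in> H #> x" using N_subset_H by (auto simp: r_coset_def)
  then have H: "H #> x = H #> y" using mem_coset_iff[OF subgroup_H] xy by blast
  have "x \<in> N \<longleftrightarrow> y \<in> N" using coset_eq_self_iff[OF subgroup_N] xy by metis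
  moreover have "x \<in> H \<longleftrightarrow> y \<in> H" using coset_eq_self_iff[OF subgroup_H] xy(1,2) H by metis
  ultimately show ?thesis using assms(2) H cls_simps(3,4) by metis
qed

text \<open>
  Each of the three classes inside H lies in one coset of N.
\<close>

lemma same_coset_if_same_class_in_H:
  assumes "x \<in> carrier G" "y \<in> cls x" "x \<in> H"
  shows "N #> y = N #> x"
proof -
  have "x \<in> N \<and> y \<in> N \<or> x \<in> N #> z \<and> y \<in> N #> z"
  proof (cases "x \<in> N")
    case True
    then have "cls x \<subseteq> N" using one_in_N by (auto simp: chain_class_def)
    then show ?thesis using assms(2) True by blast
  next
    case False
    then have "x \<in> H - N" "cls x = H - N" using assms(3) cls_simps(3) by simp_all
    then have "x \<in> N #> z" "cls x = N #> z" by (simp_all only: H_minus_N_eq_coset)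
    then show ?thesis using assms(2) by simp
  qed
  then show ?thesis
  proof
    assume "x \<in> N \<and> y \<in> N"
    then have "N #> x = N" "N #> y = N"
      using coset_eq_self_iff[OF subgroup_N] N_subset by blast+
    then show ?thesis by simp
  next
    assume "x \<in> N #> z \<and> y \<in> N #> z"
    then have "N #> z = N #> x" "N #> z = N #> y"
      using mem_coset_iff[OF subgroup_N z_carrier] r_coset_subset_G[OF N_subset z_carrier] by blast+
    then show ?thesis by simp
  qed
qed

lemma in_own_cls: "x \<in> carrier G \<Longrightarrow> x \<in> cls x"
  using rcos_self[OF _ subgroup_H] by (simp add: chain_class_def)

lemma cls_subset_carrier: "x \<in> carrier G \<Longrightarrow> cls x \<subseteq> carrier G"
  using cls_subset_coset r_coset_subset_G[OF H_subset] by (rule subset_trans)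

lemma cls_of_mem_cls:
  assumes x: "x \<in> carrier G" and y: "y \<in> cls x"
  shows "cls y = cls x"
proof (cases x rule: cls_cases)
  case 1
  then show ?thesis using y by (simp add: chain_class_def)
next
  case 2
  then have "y \<in> N" "y \<noteq> \<one>" using y cls_simps(2)[of x] by simp_all
  then show ?thesis using 2 cls_simps(2) by simp
next
  case 3
  then have "y \<in> H" "y \<notin> N" using y cls_simps(3)[of x] by simp_all
  then show ?thesis using 3 cls_simps(3) by simp
next
  case 4
  have yG: "y \<in> carrier G" using cls_subset_carrier[OF x] y by (rule subsetD)
  from 4 have coset: "H #> x = H #> y"
    using y cls_simps(4)[of x] mem_coset_iff[OF subgroup_H x yG] by simp
  then have "y \<notin> H"
    using 4 coset_eq_self_iff[OF subgroup_H x] coset_eq_self_iff[OF subgroup_H yG] by simp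
  then show ?thesis using 4 cls_simps(4) coset by simp
qed

text \<open>
  A class outside H is a union of full cosets of N.
\<close>

lemma card_cls_Int_near:
  assumes x: "x \<in> carrier G" "x \<notin> H" and w: "w \<in> cls x"
  shows "card (cls x \<inter> near `` {w}) = card N"
proof -
  have wG: "w \<in> carrier G" using cls_subset_carrier[OF x(1)] w by (rule subsetD)
  have "H #> w = cls x"
    using w x cls_simps(4)[of x] mem_coset_iff[OF subgroup_H x(1) wG] by simp
  moreover have "N #> w \<subseteq> H #> w" using N_subset_H by (auto simp: r_coset_def)
  ultimately have eq: "cls x \<inter> near `` {w} = N #> w" using near_image[OF wG] by blast
  obtain f where "bij_betw f N (N #> w)"
    using card_cosets_equal[OF rcosetsI[OF N_subset wG] N_subset] by blast
  then have "card N = card (N #> w)" by (rule bij_betw_same_card)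
  then show ?thesis unfolding eq by (rule sym)
qed

lemma near_between_layers:
  assumes "(x, y) \<in> near" "cls x \<noteq> cls y" and xy': "x' \<in> cls x" "y' \<in> cls y"
  shows "(x', y') \<in> near"
proof -
  have N: "x \<in> N" "y \<in> N" using near_different_class assms(1,2) by simp_all
  have "cls w \<subseteq> N" if "w \<in> N" for w
    using that one_in_N by (auto simp: chain_class_def)
  then have "x' \<in> N" "y' \<in> N" using N xy' by blast+
  moreover have "x' \<in> carrier G" "y' \<in> carrier G" using calculation N_subset by blast+
  ultimately have "N #> x' = N" "N #> y' = N" "x' \<in> carrier G" "y' \<in> carrier G"
    using coset_eq_self_iff[OF subgroup_N] by simp_all
  then show ?thesis unfolding same_coset_def by simp
qed

sublocale refined_partition "carrier G" cls near
proof
  fix x y assume x: "x \<in> carrier G" and y: "y \<in> cls x"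
  show "card (cls x \<inter> near `` {y}) = card (cls x \<inter> near `` {x})"
  proof (cases "x \<in> H")
    case True
    have "y \<in> carrier G" using cls_subset_carrier[OF x] y by (rule subsetD)
    then show ?thesis using same_coset_if_same_class_in_H[OF x y True] near_image x by simp
  next
    case False
    show ?thesis
      unfolding card_cls_Int_near[OF x False y] card_cls_Int_near[OF x False in_own_cls[OF x]] ..
  qed
next
  show "equiv (carrier G) near"
    by (auto intro!: equivI refl_onI symI transI simp: same_coset_def)
qed (fact finite_carrier in_own_cls cls_subset_carrier cls_of_mem_cls
    | rule near_between_layers, assumption+)+

lemma conjugacy_classes_eq: "conjugacy_classes G = parts"
  unfolding conjugacy_classes_def orbits_def using orbit_eq by blast

text \<open>
  A class determines its coset of H, so the classes of x and y determine the coset of H that contains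
  the quotient. Only if this coset is H itself is its class not yet known, and then it matters whether
  the quotient is 1 and whether it lies in N, which are the other two components of the type.
\<close>

lemma pair_type_quotient:
  assumes "x \<in> carrier G" "y \<in> carrier G" "x' \<in> carrier G" "y' \<in> carrier G"
    and "pair_type (x, y) = pair_type (x', y')"
  shows "cls (y \<otimes> inv x) = cls (y' \<otimes> inv x')"
proof -
  have type: "cls x = cls x'" "cls y = cls y'" "x = y \<longleftrightarrow> x' = y'"
    "(x, y) \<in> near \<longleftrightarrow> (x', y') \<in> near"
    using assms(5) unfolding pair_type_def fst_conv snd_conv prod.inject by blast+
  have coset: "H #> w = H #> w'" if "w \<in> carrier G" "w' \<in> carrier G" "cls w = cls w'" for w w'
    using that cls_subset_coset[OF that(1)] self_in_cls[OF that(2)] mem_coset_iff[OF subgroup_H]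
    by blast
  have quotient: "H #> (b \<otimes> inv a) = (H #> b) <#> set_inv (H #> a)"
    if "a \<in> carrier G" "b \<in> carrier G" for a b
    using that normal.rcos_inv[OF normal_H] normal.rcos_sum[OF normal_H] by simp
  have H: "H #> (y \<otimes> inv x) = H #> (y' \<otimes> inv x')"
    using quotient assms coset type by metis
  have in_H: "y \<otimes> inv x \<in> H \<longleftrightarrow> y' \<otimes> inv x' \<in> H"
    using H coset_eq_self_iff[OF subgroup_H] assms m_closed inv_closed by metis
  have in_N: "y \<otimes> inv x \<in> N \<longleftrightarrow> y' \<otimes> inv x' \<in> N"
    using type(4) assms same_coset_iff by blast
  have one: "b \<otimes> inv a = \<one> \<longleftrightarrow> a = b" if "a \<in> carrier G" "b \<in> carrier G" for a b
    using that by (metis inv_closed inv_equality inv_inv r_inv)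
  show ?thesis unfolding chain_class_def using H in_H in_N one type(3) assms by simp
qed

lemma adjacency_matrix_eq:
  "adjacency_matrix G E
    = rel_matrix {(x, y). x \<in> carrier G \<and> y \<in> carrier G \<and> y \<otimes> inv x \<in> E}"
  unfolding adjacency_matrix_def rel_matrix_def by (simp add: fun_eq_iff)

lemma dual_idempotent_eq: "dual_idempotent C = rel_matrix (Id_on C)"
  unfolding dual_idempotent_def rel_matrix_def by (auto simp: fun_eq_iff)

text \<open>
  The adjacency matrices are constant on types, and the dual idempotents are basic.
\<close>

lemma terwilliger_subset: "terwilliger_algebra G \<subseteq> cmat.span basic_matrices"
  unfolding terwilliger_algebra_def conjugacy_classes_eq
proof (rule hull_minimal, intro Un_least image_subsetI)
  show "cmat_subalgebra (carrier G) (cmat.span basic_matrices)"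
    by (rule subalgebra_span_basic_matrices)
next
  fix E assume E: "E \<in> parts"
  show "adjacency_matrix G E \<in> cmat.span basic_matrices"
    unfolding adjacency_matrix_eq
  proof (rule saturated_in_span_basic_matrices)
    fix p q
    assume p: "p \<in> {(x, y). x \<in> carrier G \<and> y \<in> carrier G \<and> y \<otimes> inv x \<in> E}"
      and q: "q \<in> carrier G \<times> carrier G" and type: "pair_type p = pair_type q"
    obtain x y where xy: "p = (x, y)" "x \<in> carrier G" "y \<in> carrier G" "y \<otimes> inv x \<in> E"
      using p by blast
    obtain x' y' where xy': "q = (x', y')" "x' \<in> carrier G" "y' \<in> carrier G"
      using q by blast
    have "cls (y' \<otimes> inv x') = cls (y \<otimes> inv x)"
      using pair_type_quotient[OF xy(2,3) xy'(2,3)] type xy(1) xy'(1) by simp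
    then have "y' \<otimes> inv x' \<in> E"
      using E xy xy' mem_part_iff[OF E] by (metis inv_closed m_closed)
    then show "q \<in> {(x, y). x \<in> carrier G \<and> y \<in> carrier G \<and> y \<otimes> inv x \<in> E}"
      using xy' by blast
  qed blast
next
  fix C assume "C \<in> parts"
  then show "dual_idempotent C \<in> cmat.span basic_matrices"
    unfolding dual_idempotent_eq basic_matrices_def basic_def by (intro cmat.span_base) blast
qed

lemma dual_idempotent_in_terwilliger:
  "C \<in> parts \<Longrightarrow> dual_idempotent C \<in> terwilliger_algebra G"
  unfolding terwilliger_algebra_def conjugacy_classes_eq by (intro hull_inc) blast

text \<open>
  Multiplying by dual idempotents on both sides restricts a matrix to a block.
\<close>

lemma cut_in_terwilliger:
  assumes "rel_matrix R \<in> terwilliger_algebra G" "C \<in> parts" "D \<in> parts"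
  shows "rel_matrix (R \<inter> C \<times> D) \<in> terwilliger_algebra G"
proof -
  let ?X = "carrier G"
  have mult: "cmat_mult ?X M M' \<in> terwilliger_algebra G"
    if "M \<in> terwilliger_algebra G" "M' \<in> terwilliger_algebra G" for M M'
    using that cmat_subalgebra_hull[of ?X] unfolding terwilliger_algebra_def cmat_subalgebra_def
    by blast
  have idem: "rel_matrix (Id_on E) \<in> terwilliger_algebra G" if "E \<in> parts" for E
    using dual_idempotent_in_terwilliger[OF that] by (simp only: dual_idempotent_eq)
  have "{y \<in> ?X. (x, y) \<in> Id_on C \<and> (y, w) \<in> R} = (if (x, w) \<in> R \<inter> C \<times> UNIV then {x} else {})"
    for x w using part_subset[OF assms(2)] by auto
  then have left: "cmat_mult ?X (rel_matrix (Id_on C)) (rel_matrix R)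
      = cmat_scale (of_nat 1) (rel_matrix (R \<inter> C \<times> UNIV))"
    by (intro cmat_mult_rel_matrix_scale finite_carrier) simp
  have "{y \<in> ?X. (x, y) \<in> R \<inter> C \<times> UNIV \<and> (y, w) \<in> Id_on D}
      = (if (x, w) \<in> R \<inter> C \<times> D then {w} else {})"
    for x w using part_subset[OF assms(3)] by auto
  then have right: "cmat_mult ?X (rel_matrix (R \<inter> C \<times> UNIV)) (rel_matrix (Id_on D))
      = cmat_scale (of_nat 1) (rel_matrix (R \<inter> C \<times> D))"
    by (intro cmat_mult_rel_matrix_scale finite_carrier) simp
  have "cmat_mult ?X (cmat_mult ?X (rel_matrix (Id_on C)) (rel_matrix R)) (rel_matrix (Id_on D))
      \<in> terwilliger_algebra G"
    by (intro mult idem assms)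
  then show ?thesis unfolding left cmat.scale_one of_nat_1 right .
qed

text \<open>
  Sums of adjacency matrices; all classes together give the all-ones matrix, and the two classes inside
  N give the relation of lying in the same coset of N.
\<close>

lemma union_of_classes_in_terwilliger:
  assumes "\<E> \<subseteq> parts"
  shows "rel_matrix {(x, y). x \<in> carrier G \<and> y \<in> carrier G \<and> y \<otimes> inv x \<in> \<Union>\<E>}
    \<in> terwilliger_algebra G"
proof -
  let ?A = "\<lambda>E. {(x, y). x \<in> carrier G \<and> y \<in> carrier G \<and> y \<otimes> inv x \<in> E}"
  have "disjoint_family_on ?A \<E>"
    unfolding disjoint_family_on_def
  proof (intro ballI impI)
    fix E E' assume E: "E \<in> \<E>" "E' \<in> \<E>" "E \<noteq> E'"
    then have "E \<inter> E' = {}" using assms parts_disjoint[of E E'] by blast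
    then show "?A E \<inter> ?A E' = {}" by blast
  qed
  moreover have "finite \<E>" using assms finite_carrier finite_subset by blast
  moreover have "?A (\<Union>\<E>) = (\<Union>E\<in>\<E>. ?A E)" by blast
  ultimately have "rel_matrix (?A (\<Union>\<E>)) = (\<Sum>E\<in>\<E>. adjacency_matrix G E)"
    by (simp only: rel_matrix_UN_disjoint adjacency_matrix_eq)
  also have "\<dots> \<in> terwilliger_algebra G"
  proof (rule cmat.subspace_sum)
    show "cmat.subspace (terwilliger_algebra G)"
      using cmat_subalgebra_hull unfolding terwilliger_algebra_def cmat_subalgebra_def by blast
    show "adjacency_matrix G E \<in> terwilliger_algebra G" if "E \<in> \<E>" for E
      using that assms unfolding terwilliger_algebra_def conjugacy_classes_eq
      by (intro hull_inc) blast
  qed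
  finally show ?thesis .
qed

lemma layers_in_parts: "{\<one>} \<in> parts" "N - {\<one>} \<in> parts" "H - N \<in> parts"
proof -
  show "{\<one>} \<in> parts" using cls_simps(1) one_closed by (metis image_eqI)
  have "N \<noteq> {\<one>}" using card_N by auto
  then obtain n where "n \<in> N" "n \<noteq> \<one>" using one_in_N by blast
  then show "N - {\<one>} \<in> parts" using cls_simps(2) N_subset by (metis image_eqI subsetD)
  have "z \<in> H" using H_minus_N_eq_coset rcos_self[OF z_carrier subgroup_N] by blast
  then show "H - N \<in> parts" using cls_simps(3) z_notin_N z_carrier by (metis image_eqI)
qed

lemma terwilliger_supset: "cmat.span basic_matrices \<subseteq> terwilliger_algebra G"
proof (rule cmat.span_minimal)
  show "cmat.subspace (terwilliger_algebra G)"
    using cmat_subalgebra_hull unfolding terwilliger_algebra_def cmat_subalgebra_def by blast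
  have all: "rel_matrix (carrier G \<times> carrier G) \<in> terwilliger_algebra G"
  proof -
    have "\<Union>parts = carrier G" using self_in_cls cls_subset by blast
    then have "{(x, y). x \<in> carrier G \<and> y \<in> carrier G \<and> y \<otimes> inv x \<in> \<Union>parts}
        = carrier G \<times> carrier G" by auto
    then show ?thesis using union_of_classes_in_terwilliger[OF subset_refl] by (simp only:)
  qed
  have near: "rel_matrix near \<in> terwilliger_algebra G"
  proof -
    have union: "\<Union>{{\<one>}, N - {\<one>}} = N" using one_in_N by blast
    have "{(x, y). x \<in> carrier G \<and> y \<in> carrier G \<and> y \<otimes> inv x \<in> N} = near"
      by (auto simp: same_coset_iff)
    moreover have "{{\<one>}, N - {\<one>}} \<subseteq> parts" using layers_in_parts by simp
    ultimately show ?thesis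
      using union_of_classes_in_terwilliger[of "{{\<one>}, N - {\<one>}}"] by (simp only: union)
  qed
  show "basic_matrices \<subseteq> terwilliger_algebra G"
  proof
    fix M assume "M \<in> basic_matrices"
    then obtain C D R where M: "M = rel_matrix R" "C \<in> parts" "D \<in> parts" "basic C D R"
      unfolding basic_matrices_def by blast
    from M(4) consider "R = C \<times> D" | "C = D" "R = near \<inter> C \<times> C" | "C = D" "R = Id_on C"
      unfolding basic_def by blast
    then show "M \<in> terwilliger_algebra G"
    proof cases
      case 1
      have "carrier G \<times> carrier G \<inter> C \<times> D = R"
        using 1 part_subset[OF M(2)] part_subset[OF M(3)] by blast
      then show ?thesis using cut_in_terwilliger[OF all M(2,3)] M(1) by (simp only:)
    next
      case 2
      then show ?thesis using cut_in_terwilliger[OF near M(2,2)] M(1) by (simp only:)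
    next
      case 3
      then show ?thesis
        using M(1,2) dual_idempotent_in_terwilliger by (simp add: dual_idempotent_eq)
    qed
  qed
qed

lemma parts_eq: "parts = {{\<one>}, N - {\<one>}, H - N} \<union> (rcosets H - {H})"
proof
  have "cls x \<in> {{\<one>}, N - {\<one>}, H - N} \<union> (rcosets H - {H})" if x: "x \<in> carrier G" for x
  proof (cases "x \<in> H")
    case True
    then show ?thesis by (auto simp: chain_class_def)
  next
    case False
    then show ?thesis
      using rcosetsI[OF H_subset x] coset_eq_self_iff[OF subgroup_H x] cls_simps(4) by simp
  qed
  then show "parts \<subseteq> {{\<one>}, N - {\<one>}, H - N} \<union> (rcosets H - {H})" by blast
  have "C \<in> parts" if C: "C \<in> rcosets H" "C \<noteq> H" for C
  proof -
    obtain x where x: "x \<in> carrier G" "C = H #> x" using C(1) unfolding RCOSETS_def by blast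
    then have "C = cls x" using C(2) coset_eq_self_iff[OF subgroup_H x(1)] cls_simps(4) by simp
    then show ?thesis using x(1) by blast
  qed
  then have "rcosets H - {H} \<subseteq> parts" by blast
  then show "{{\<one>}, N - {\<one>}, H - N} \<union> (rcosets H - {H}) \<subseteq> parts"
    using layers_in_parts by simp
qed

lemma part_nonempty: "C \<in> parts \<Longrightarrow> C \<noteq> {}"
  using self_in_cls by blast

lemma H_in_rcosets: "H \<in> rcosets H"
  by (rule subgroup.subgroup_in_rcosets[OF subgroup_H group_axioms])

lemma layer_not_coset:
  assumes "C \<in> parts" "C \<subseteq> H"
  shows "C \<notin> rcosets H - {H}"
proof
  assume "C \<in> rcosets H - {H}"
  then have "C \<inter> H = {}"
    using rcos_disjoint[OF subgroup_H] H_in_rcosets unfolding pairwise_def disjnt_def by blast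
  then show False using assms part_nonempty by blast
qed

lemma card_parts: "card parts = card (rcosets H) + 2"
proof -
  have fin: "finite (rcosets H)"
    using finite_carrier unfolding RCOSETS_def by simp
  have "N - {\<one>} \<noteq> {}" "H - N \<noteq> {}"
    using part_nonempty[OF layers_in_parts(2)] part_nonempty[OF layers_in_parts(3)] .
  then have "card {{\<one>}, N - {\<one>}, H - N} = 3"
    using one_in_N by (subst card_3_iff) blast
  moreover have "{{\<one>}, N - {\<one>}, H - N} \<inter> (rcosets H - {H}) = {}"
    using layer_not_coset[OF layers_in_parts(1)] layer_not_coset[OF layers_in_parts(2)]
      layer_not_coset[OF layers_in_parts(3)] one_in_N N_subset_H
    by auto
  moreover have "card (rcosets H) = Suc (card (rcosets H - {H}))"
    using fin H_in_rcosets by (simp only: card_Suc_Diff1)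
  ultimately show ?thesis
    unfolding parts_eq using fin by (subst card_Un_disjoint) simp_all
qed

text \<open>
  Inside N two distinct non-identity elements are available because N has at least three elements.
  Any class outside N contains, with x, the whole coset of N through x.
\<close>

lemma near_pair_in_part_iff:
  assumes C: "C \<in> parts"
  shows "(\<exists>x\<in>C. \<exists>y\<in>C. x \<noteq> y \<and> (x, y) \<in> near) \<longleftrightarrow> C \<noteq> {\<one>}"
proof
  assume "C \<noteq> {\<one>}"
  have "finite N" using finite_subset[OF N_subset finite_carrier] .
  then have "\<not> card (N - {\<one>}) \<le> Suc 0"
    using card_N one_in_N by (simp add: card_Diff_singleton)
  then obtain m n where mn: "m \<in> N" "n \<in> N" "m \<noteq> n" "m \<noteq> \<one>" "n \<noteq> \<one>"
    using card_le_Suc0_iff_eq[of "N - {\<one>}"] \<open>finite N\<close> by blast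
  have mG: "m \<in> carrier G" using mn N_subset by blast
  show "\<exists>x\<in>C. \<exists>y\<in>C. x \<noteq> y \<and> (x, y) \<in> near"
  proof (cases "C = N - {\<one>}")
    case True
    have "N #> m = N" "N #> n = N"
      using mn N_subset coset_eq_self_iff[OF subgroup_N] by blast+
    then have "(m, n) \<in> near"
      using mn N_subset unfolding same_coset_def by auto
    then show ?thesis using mn True by blast
  next
    case False
    obtain x where x: "x \<in> carrier G" "C = cls x" using C by blast
    have "x \<notin> N" using \<open>C \<noteq> {\<one>}\<close> False x(2) cls_simps(1,2) by metis
    have "N #> x \<subseteq> C"
    proof (cases "x \<in> H")
      case True
      then have "x \<in> H - N" "C = H - N" using \<open>x \<notin> N\<close> x(2) cls_simps(3) by simp_all
      then have "x \<in> N #> z" "C = N #> z" by (simp_all only: H_minus_N_eq_coset)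
      then show ?thesis using mem_coset_iff[OF subgroup_N z_carrier x(1)] by simp
    next
      case False
      then have "C = H #> x" using x(2) cls_simps(4) by simp
      then show ?thesis using N_subset_H by (auto simp: r_coset_def)
    qed
    moreover have mx: "m \<otimes> x \<in> N #> x" using mn(1) by (auto simp: r_coset_def)
    moreover have "m \<otimes> x \<noteq> x" using mn(4) mG x(1) by simp
    moreover have "(x, m \<otimes> x) \<in> near"
      using near_image[OF x(1)] mx by blast
    moreover have "x \<in> C" using in_own_cls x by simp
    ultimately show ?thesis by (metis subsetD)
  qed
qed blast

text \<open>
  A class outside H is a coset of H and hence contains both x and zx, which lie in different cosets of N.
\<close>

lemma far_pair_in_part_iff:
  assumes C: "C \<in> parts"
  shows "(\<exists>x\<in>C. \<exists>y\<in>C. (x, y) \<notin> near) \<longleftrightarrow> C \<in> rcosets H - {H}"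
proof -
  obtain x where x: "x \<in> carrier G" "C = cls x" using C by blast
  show ?thesis
  proof (cases "x \<in> H")
    case True
    have coset: "N #> y = N #> x" if "y \<in> C" for y
      using same_coset_if_same_class_in_H[OF x(1) _ True] x(2) that by simp
    have "(a, b) \<in> near" if "a \<in> C" "b \<in> C" for a b
      using coset[OF that(1)] coset[OF that(2)] that part_subset[OF C]
      unfolding same_coset_def by auto
    moreover have "C \<subseteq> H"
      using cls_subset_coset[OF x(1)] coset_eq_self_iff[OF subgroup_H x(1)] True x(2) by simp
    ultimately show ?thesis using layer_not_coset[OF C] by blast
  next
    case False
    then have CH: "C = H #> x" using x(2) cls_simps(4) by simp
    have "z \<in> H" using H_minus_N_eq_coset rcos_self[OF z_carrier subgroup_N] by blast
    then have "z \<otimes> x \<in> C" unfolding CH by (auto simp: r_coset_def)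
    moreover have "x \<in> C" using in_own_cls x by simp
    moreover have "(x, z \<otimes> x) \<notin> near"
      using same_coset_iff x(1) z_carrier z_notin_N by (simp add: m_assoc)
    moreover have "C \<in> rcosets H - {H}"
      using rcosetsI[OF H_subset x(1)] coset_eq_self_iff[OF subgroup_H x(1)] CH False
      by simp
    ultimately show ?thesis by blast
  qed
qed

text \<open>
  If H has r cosets, there are r + 2 classes. All of them but {1} contain distinct elements of the same
  coset of N, and r - 1 of them contain elements of different cosets of N.
\<close>

theorem dim_terwilliger_algebra:
  "cmat.dim (terwilliger_algebra G) = (card (rcosets H) + 2)\<^sup>2 + 2 * card (rcosets H)"
proof -
  have fin: "finite (rcosets H)"
    using finite_carrier unfolding RCOSETS_def by simp
  have "{C \<in> parts. \<exists>x\<in>C. \<exists>y\<in>C. x \<noteq> y \<and> (x, y) \<in> near} = {C \<in> parts. C \<noteq> {\<one>}}"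
    by (intro Collect_cong conj_cong refl near_pair_in_part_iff)
  also have "\<dots> = parts - {{\<one>}}" by blast
  finally have near_eq: "{C \<in> parts. \<exists>x\<in>C. \<exists>y\<in>C. x \<noteq> y \<and> (x, y) \<in> near} = parts - {{\<one>}}" .
  have near: "card {C \<in> parts. \<exists>x\<in>C. \<exists>y\<in>C. x \<noteq> y \<and> (x, y) \<in> near} = card (rcosets H) + 1"
    unfolding near_eq using card_Diff_singleton[OF layers_in_parts(1)] card_parts by linarith
  have "{C \<in> parts. \<exists>x\<in>C. \<exists>y\<in>C. (x, y) \<notin> near} = {C \<in> parts. C \<in> rcosets H - {H}}"
    by (intro Collect_cong conj_cong refl far_pair_in_part_iff)
  also have "\<dots> = rcosets H - {H}" unfolding parts_eq by blast
  finally have far_eq: "{C \<in> parts. \<exists>x\<in>C. \<exists>y\<in>C. (x, y) \<notin> near} = rcosets H - {H}" .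
  have far: "card {C \<in> parts. \<exists>x\<in>C. \<exists>y\<in>C. (x, y) \<notin> near} = card (rcosets H) - 1"
    unfolding far_eq by (rule card_Diff_singleton[OF H_in_rcosets])
  have "card (rcosets H) > 0" using fin H_in_rcosets card_gt_0_iff by blast
  moreover have "terwilliger_algebra G = cmat.span basic_matrices"
    by (rule equalityI[OF terwilliger_subset terwilliger_supset])
  then have "cmat.dim (terwilliger_algebra G)
      = (card (rcosets H) + 2)\<^sup>2 + (card (rcosets H) + 1) + (card (rcosets H) - 1)"
    using dim_span_basic_matrices unfolding card_parts near far by (simp only:)
  ultimately show ?thesis by linarith
qed

end

section \<open>Conjugation\<close>

text \<open>
  Naming the conjugate keeps rewriting from reassociating the factors, so that conjugation can be used
  as a group action by automorphisms.
\<close>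

definition conj_by :: "('g, 'm) monoid_scheme \<Rightarrow> 'g \<Rightarrow> 'g \<Rightarrow> 'g" where
  "conj_by G g x = g \<otimes>\<^bsub>G\<^esub> x \<otimes>\<^bsub>G\<^esub> inv\<^bsub>G\<^esub> g"

context group
begin

lemma inv_cancel_left:
  "x \<in> carrier G \<Longrightarrow> y \<in> carrier G \<Longrightarrow> inv x \<otimes> (x \<otimes> y) = y"
  "x \<in> carrier G \<Longrightarrow> y \<in> carrier G \<Longrightarrow> x \<otimes> (inv x \<otimes> y) = y"
  by (simp_all add: m_assoc[symmetric])

lemma conj_by_closed: "g \<in> carrier G \<Longrightarrow> x \<in> carrier G \<Longrightarrow> conj_by G g x \<in> carrier G"
  by (simp add: conj_by_def)

lemma conj_by_one: "x \<in> carrier G \<Longrightarrow> conj_by G \<one> x = x"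
  by (simp add: conj_by_def)

lemma conj_by_conj_by:
  "g \<in> carrier G \<Longrightarrow> h \<in> carrier G \<Longrightarrow> x \<in> carrier G \<Longrightarrow>
    conj_by G g (conj_by G h x) = conj_by G (g \<otimes> h) x"
  by (simp add: conj_by_def m_assoc inv_mult_group)

lemma conj_by_mult:
  "g \<in> carrier G \<Longrightarrow> x \<in> carrier G \<Longrightarrow> y \<in> carrier G \<Longrightarrow>
    conj_by G g (x \<otimes> y) = conj_by G g x \<otimes> conj_by G g y"
  by (simp add: conj_by_def m_assoc inv_cancel_left)

lemma conj_by_inv:
  "g \<in> carrier G \<Longrightarrow> x \<in> carrier G \<Longrightarrow> conj_by G g (inv x) = inv (conj_by G g x)"
  by (simp add: conj_by_def m_assoc inv_mult_group)

lemma conj_by_eq_iff_commute: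
  "g \<in> carrier G \<Longrightarrow> x \<in> carrier G \<Longrightarrow> y \<in> carrier G \<Longrightarrow>
    conj_by G g x = y \<longleftrightarrow> g \<otimes> x = y \<otimes> g"
  by (metis conj_by_def inv_closed inv_solve_right m_closed)

lemma conj_by_eq_one_iff:
  assumes "g \<in> carrier G" "x \<in> carrier G"
  shows "conj_by G g x = \<one> \<longleftrightarrow> x = \<one>"
  using conj_by_eq_iff_commute[OF assms one_closed] assms by simp

lemma conj_by_in_normal: "K \<lhd> G \<Longrightarrow> g \<in> carrier G \<Longrightarrow> x \<in> K \<Longrightarrow> conj_by G g x \<in> K"
  unfolding conj_by_def by (rule normal.inv_op_closed2)

lemma conj_by_in_normal_iff:
  assumes "K \<lhd> G" "g \<in> carrier G" "x \<in> carrier G"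
  shows "conj_by G g x \<in> K \<longleftrightarrow> x \<in> K"
proof
  assume "conj_by G g x \<in> K"
  then have "conj_by G (inv g) (conj_by G g x) \<in> K"
    using conj_by_in_normal assms by simp
  then show "x \<in> K" using assms by (simp add: conj_by_conj_by conj_by_one)
qed (rule conj_by_in_normal[OF assms(1,2)])

definition conj_class :: "'a \<Rightarrow> 'a set" where
  "conj_class x = (\<lambda>g. conj_by G g x) ` carrier G"

lemma orbit_eq_conj_class:
  assumes "x \<in> carrier G"
  shows "orbit G (\<lambda>g. \<lambda>h\<in>carrier G. g \<otimes> h \<otimes> inv g) x = conj_class x"
  using assms unfolding orbit_def conj_class_def conj_by_def by auto

lemma conj_class_self: "x \<in> carrier G \<Longrightarrow> x \<in> conj_class x"
  unfolding conj_class_def using conj_by_one by (metis image_eqI one_closed)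

lemma conj_class_subset: "x \<in> carrier G \<Longrightarrow> conj_class x \<subseteq> carrier G"
  unfolding conj_class_def using conj_by_closed by blast

lemma conj_class_trans:
  assumes "x \<in> carrier G" "y \<in> conj_class x" "w \<in> conj_class y"
  shows "w \<in> conj_class x"
proof -
  obtain g h where "g \<in> carrier G" "h \<in> carrier G" "y = conj_by G g x" "w = conj_by G h y"
    using assms(2,3) unfolding conj_class_def by blast
  then have "w = conj_by G (h \<otimes> g) x" "h \<otimes> g \<in> carrier G"
    using assms(1) by (simp_all add: conj_by_conj_by)
  then show ?thesis unfolding conj_class_def by blast
qed

lemma conj_class_sym:
  assumes "x \<in> carrier G" "y \<in> conj_class x"
  shows "x \<in> conj_class y"
proof -
  obtain g where "g \<in> carrier G" "y = conj_by G g x"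
    using assms(2) unfolding conj_class_def by blast
  then have "x = conj_by G (inv g) y" "inv g \<in> carrier G"
    using assms(1) by (simp_all add: conj_by_conj_by conj_by_one)
  then show ?thesis unfolding conj_class_def by blast
qed

end

section \<open>The structure of the quaternion group\<close>

lemma quaternion_group_carrier:
  "carrier quaternion_group = {(1, 0, 0, 0), (-1, 0, 0, 0), (0, 1, 0, 0), (0, -1, 0, 0),
     (0, 0, 1, 0), (0, 0, -1, 0), (0, 0, 0, 1), (0, 0, 0, -1)}"
  by (simp add: quaternion_group_def)

lemma quaternion_group_mult: "mult quaternion_group = hamilton_mult"
  by (simp add: quaternion_group_def)

lemma card_quaternion_group: "card (carrier quaternion_group) = 8"
  by (simp add: quaternion_group_carrier)

text \<open>
  The properties of the quaternion group with central involution z that the argument needs: the other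
  non-identity elements square to z, and each of them is conjugate to its product with z and to no
  further element.
\<close>

locale quaternion_subgroup = group G for G (structure) +
  fixes Q :: "'a set" and z :: 'a
  assumes subgroup_Q: "subgroup Q G"
    and card_Q: "card Q = 8"
    and z_in_Q: "z \<in> Q" and z_not_one: "z \<noteq> \<one>"
    and z_central: "q \<in> Q \<Longrightarrow> z \<otimes> q = q \<otimes> z"
    and square_eq_z: "q \<in> Q \<Longrightarrow> q \<noteq> \<one> \<Longrightarrow> q \<noteq> z \<Longrightarrow> q \<otimes> q = z"
    and commute_up_to_z: "p \<in> Q \<Longrightarrow> q \<in> Q \<Longrightarrow> p \<otimes> q = q \<otimes> p \<or> p \<otimes> q = z \<otimes> (q \<otimes> p)"
    and anticommute: "q \<in> Q \<Longrightarrow> q \<noteq> \<one> \<Longrightarrow> q \<noteq> z \<Longrightarrow> \<exists>p\<in>Q. p \<otimes> q = z \<otimes> (q \<otimes> p)"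
    and z_square: "z \<otimes> z = \<one>"

text \<open>
  Each property is an identity between quaternion units, checked on the eight units and pulled back
  along the isomorphism.
\<close>

lemma (in group) quaternion_subgroup_if_iso:
  assumes Q: "subgroup Q G" and iso: "G\<lparr>carrier := Q\<rparr> \<cong> quaternion_group"
  obtains z where "quaternion_subgroup G Q z"
proof -
  obtain h where h: "h \<in> iso (G\<lparr>carrier := Q\<rparr>) quaternion_group"
    using iso unfolding is_iso_def by blast
  have bij: "bij_betw h Q (carrier quaternion_group)"
    using h unfolding iso_def by simp
  have hom: "h (p \<otimes> q) = hamilton_mult (h p) (h q)" if "p \<in> Q" "q \<in> Q" for p q
    using h that unfolding iso_def hom_def quaternion_group_mult by simp
  have closed: "p \<otimes> q \<in> Q" if "p \<in> Q" "q \<in> Q" for p q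
    using subgroup.m_closed[OF Q that] .
  have inj: "p = q" if "p \<in> Q" "q \<in> Q" "h p = h q" for p q
    using bij that unfolding bij_betw_def inj_on_def by blast
  have mem: "h q \<in> carrier quaternion_group" if "q \<in> Q" for q
    using bij that unfolding bij_betw_def by blast
  have surj: "\<exists>q\<in>Q. h q = u" if "u \<in> carrier quaternion_group" for u
  proof -
    have "u \<in> h ` Q" using bij_betw_imp_surj_on[OF bij] that by simp
    then show ?thesis by blast
  qed
  have one: "\<one> \<in> Q" "h \<one> = (1, 0, 0, 0)"
  proof -
    show "\<one> \<in> Q" using Q by (rule subgroup.one_closed)
    then have "hamilton_mult (h \<one>) (h \<one>) = h \<one>" "h \<one> \<in> carrier quaternion_group"
      using hom[of \<one> \<one>] mem[of \<one>] by simp_all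
    then show "h \<one> = (1, 0, 0, 0)"
      unfolding quaternion_group_carrier by auto
  qed
  obtain z where z: "z \<in> Q" "h z = (-1, 0, 0, 0)"
    using surj[of "(-1, 0, 0, 0)"] unfolding quaternion_group_carrier by auto
  have "quaternion_subgroup G Q z"
  proof (rule quaternion_subgroup.intro[OF group_axioms quaternion_subgroup_axioms.intro])
    show "card Q = 8" using bij_betw_same_card[OF bij] card_quaternion_group by simp
    show "z \<noteq> \<one>" using z one by auto
    show "z \<otimes> z = \<one>" by (rule inj) (simp_all add: closed hom z one)
  next
    fix q assume q: "q \<in> Q"
    show "z \<otimes> q = q \<otimes> z"
      using mem[OF q] by (intro inj) (auto simp: closed hom z q quaternion_group_carrier)
  next
    fix q assume q: "q \<in> Q" "q \<noteq> \<one>" "q \<noteq> z"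
    have ne: "h q \<noteq> (1, 0, 0, 0)" "h q \<noteq> (-1, 0, 0, 0)"
      using inj[OF q(1) one(1)] inj[OF q(1) z(1)] q one z by auto
    show "q \<otimes> q = z"
      using mem[OF q(1)] ne by (intro inj) (auto simp: closed hom z q quaternion_group_carrier)
    have "\<exists>u\<in>carrier quaternion_group.
        hamilton_mult u (h q) = hamilton_mult (-1, 0, 0, 0) (hamilton_mult (h q) u)"
      using mem[OF q(1)] ne unfolding quaternion_group_carrier by auto
    then obtain p where p: "p \<in> Q"
      "hamilton_mult (h p) (h q) = hamilton_mult (-1, 0, 0, 0) (hamilton_mult (h q) (h p))"
      using surj by metis
    have "p \<otimes> q = z \<otimes> (q \<otimes> p)"
      using p q z by (intro inj) (simp_all add: closed hom)
    then show "\<exists>p\<in>Q. p \<otimes> q = z \<otimes> (q \<otimes> p)" using p(1) by blast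
  next
    fix p q assume pq: "p \<in> Q" "q \<in> Q"
    have "hamilton_mult (h p) (h q) = hamilton_mult (h q) (h p)
      \<or> hamilton_mult (h p) (h q) = hamilton_mult (-1, 0, 0, 0) (hamilton_mult (h q) (h p))"
      using mem[OF pq(1)] mem[OF pq(2)] unfolding quaternion_group_carrier by auto
    then have "h (p \<otimes> q) = h (q \<otimes> p) \<or> h (p \<otimes> q) = h (z \<otimes> (q \<otimes> p))"
      using pq z by (simp add: closed hom)
    then show "p \<otimes> q = q \<otimes> p \<or> p \<otimes> q = z \<otimes> (q \<otimes> p)"
      using inj closed pq z(1) by meson
  qed (fact Q z(1))+
  then show thesis by (rule that)
qed

section \<open>The faithful semidirect product\<close>

locale faithful_quaternion_product = quaternion_subgroup +
  fixes N :: "'a set"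
  assumes normal_N: "N \<lhd> G" and Int_one: "N \<inter> Q = {\<one>}" and NQ: "N <#> Q = carrier G"
    and card_N: "card N = 9"
    and N_commute: "m \<in> N \<Longrightarrow> n \<in> N \<Longrightarrow> m \<otimes> n = n \<otimes> m"
    and N_cube: "n \<in> N \<Longrightarrow> n \<otimes> n \<otimes> n = \<one>"
    and faithful: "q \<in> Q \<Longrightarrow> (\<And>n. n \<in> N \<Longrightarrow> conj_by G q n = n) \<Longrightarrow> q = \<one>"
begin

lemma subgroup_N: "subgroup N G"
  using normal_N by (rule normal_imp_subgroup)

lemma N_carrier: "n \<in> N \<Longrightarrow> n \<in> carrier G"
  using subgroup.subset[OF subgroup_N] by blast

lemma Q_carrier: "q \<in> Q \<Longrightarrow> q \<in> carrier G"
  using subgroup.subset[OF subgroup_Q] by blast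

lemmas N_closed = subgroup.m_closed[OF subgroup_N] subgroup.m_inv_closed[OF subgroup_N]
lemmas Q_closed = subgroup.m_closed[OF subgroup_Q] subgroup.m_inv_closed[OF subgroup_Q]

lemma one_mem: "\<one> \<in> N" "\<one> \<in> Q"
  using Int_one by blast+

lemma conj_by_Q_in_N: "q \<in> Q \<Longrightarrow> n \<in> N \<Longrightarrow> conj_by G q n \<in> N"
  using conj_by_in_normal[OF normal_N] Q_carrier by blast

lemma z_carrier: "z \<in> carrier G"
  using z_in_Q by (rule Q_carrier)

lemma z_notin_N: "z \<notin> N"
  using Int_one z_in_Q z_not_one by blast

lemma finite_N: "finite N"
  using card_N by (auto intro: card_ge_0_finite)

lemma eq_one_if_eq_inv:
  assumes "n \<in> N" "n = inv n"
  shows "n = \<one>"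
proof -
  have nG: "n \<in> carrier G" using assms(1) by (rule N_carrier)
  have "n \<otimes> n = n \<otimes> inv n" using assms(2) by (rule arg_cong)
  then have "n \<otimes> n = \<one>" using nG by simp
  then show ?thesis using N_cube[OF assms(1)] nG by simp
qed

lemma conj_by_Q_twice:
  assumes "q \<in> Q" "n \<in> N"
  shows "conj_by G q (conj_by G q n) = conj_by G (q \<otimes> q) n"
  using assms Q_carrier N_carrier by (intro conj_by_conj_by) auto

lemma conj_by_z_conj_by:
  assumes "q \<in> Q" "n \<in> N"
  shows "conj_by G z (conj_by G q n) = conj_by G q (conj_by G z n)"
  using conj_by_conj_by[OF z_carrier Q_carrier[OF assms(1)] N_carrier[OF assms(2)]]
    conj_by_conj_by[OF Q_carrier[OF assms(1)] z_carrier N_carrier[OF assms(2)]]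
    z_central[OF assms(1)] by simp

text \<open>
  Since N is commutative, this is a subgroup, and its order can be studied by Lagrange's theorem.
\<close>

definition inverted :: "'a set" where
  "inverted = {n \<in> N. conj_by G z n = inv n}"

lemma subgroup_inverted: "subgroup inverted G"
proof (rule subgroupI)
  show "inverted \<subseteq> carrier G" using N_carrier unfolding inverted_def by blast
  have "conj_by G z \<one> = inv \<one>" using z_carrier by (simp add: conj_by_def)
  then have "\<one> \<in> inverted" using one_mem(1) by (simp add: inverted_def)
  then show "inverted \<noteq> {}" by blast
next
  fix n assume "n \<in> inverted"
  then have n: "n \<in> N" "conj_by G z n = inv n" by (simp_all add: inverted_def)
  have "conj_by G z (inv n) = inv (inv n)"
    using conj_by_inv[OF z_carrier N_carrier[OF n(1)]] n(2) by (simp only:)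
  then show "inv n \<in> inverted" using N_closed(2)[OF n(1)] by (simp add: inverted_def)
next
  fix m n assume "m \<in> inverted" "n \<in> inverted"
  then have m: "m \<in> N" "conj_by G z m = inv m" and n: "n \<in> N" "conj_by G z n = inv n"
    by (simp_all add: inverted_def)
  have G: "m \<in> carrier G" "n \<in> carrier G" using m n N_carrier by simp_all
  have "conj_by G z (m \<otimes> n) = inv m \<otimes> inv n"
    unfolding conj_by_mult[OF z_carrier G] m(2) n(2) ..
  also have "\<dots> = inv n \<otimes> inv m"
    using N_commute N_closed(2) m(1) n(1) by simp
  also have "\<dots> = inv (m \<otimes> n)" using inv_mult_group[OF G] by (rule sym)
  finally show "m \<otimes> n \<in> inverted"
    using N_closed(1)[OF m(1) n(1)] by (simp add: inverted_def)
qed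

lemma displacement_inverted:
  assumes n: "n \<in> N"
  shows "n \<otimes> inv (conj_by G z n) \<in> inverted"
proof -
  let ?m = "conj_by G z n"
  have m: "?m \<in> N" using conj_by_Q_in_N z_in_Q n by blast
  have "conj_by G z ?m = n"
    using conj_by_Q_twice[OF z_in_Q n] z_square N_carrier[OF n] by (simp add: conj_by_one)
  then have "conj_by G z (n \<otimes> inv ?m) = ?m \<otimes> inv n"
    using n m N_carrier z_carrier by (simp add: conj_by_mult conj_by_inv)
  also have "\<dots> = inv (n \<otimes> inv ?m)"
    using n m N_carrier by (simp add: inv_mult_group)
  finally show ?thesis unfolding inverted_def using N_closed n m by simp
qed

text \<open>
  Conjugation by some q with square z would act on the three elements 1, m and the inverse of m. It fixes
  or inverts m, so in either case its square, conjugation by z, fixes m. But z also inverts m, and m is not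
  an involution.
\<close>

lemma card_inverted_ne_3: "card inverted \<noteq> 3"
proof
  assume card: "card inverted = 3"
  have sub: "inverted \<subseteq> N" unfolding inverted_def by blast
  have one: "\<one> \<in> inverted" using subgroup.one_closed[OF subgroup_inverted] .
  have fin: "finite inverted" using finite_subset[OF sub finite_N] .
  have "\<not> inverted \<subseteq> {\<one>}" using card card_mono[of "{\<one>}" inverted] by auto
  then obtain m where m: "m \<in> inverted" "m \<noteq> \<one>" by blast
  have mN: "m \<in> N" and mG: "m \<in> carrier G" using m sub N_carrier by blast+
  have im: "inv m \<in> inverted" using subgroup.m_inv_closed[OF subgroup_inverted m(1)] .
  have "m \<noteq> inv m" using eq_one_if_eq_inv[OF mN] m(2) by blast
  moreover have "inv m \<noteq> \<one>" using m(2) mG by simp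
  ultimately have "card {\<one>, m, inv m} = 3" using m(2) by simp
  then have all: "inverted = {\<one>, m, inv m}"
    using card_subset_eq[OF fin, of "{\<one>, m, inv m}"] one m(1) im card by simp
  have "\<not> Q \<subseteq> {\<one>, z}"
  proof
    assume "Q \<subseteq> {\<one>, z}"
    then have "card Q \<le> card {\<one>, z}" by (intro card_mono) auto
    also have "\<dots> \<le> 2" by (simp add: card_insert_if)
    finally show False using card_Q by simp
  qed
  then obtain q where q: "q \<in> Q" "q \<noteq> \<one>" "q \<noteq> z" by blast
  have qG: "q \<in> carrier G" using q Q_carrier by blast
  have "conj_by G q m \<in> inverted"
  proof -
    have "conj_by G z m = inv m" using m(1) by (simp add: inverted_def)
    then have "conj_by G z (conj_by G q m) = inv (conj_by G q m)"
      using conj_by_z_conj_by[OF q(1) mN] conj_by_inv[OF qG mG] by simp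
    then show ?thesis unfolding inverted_def using conj_by_Q_in_N[OF q(1) mN] by simp
  qed
  moreover have "conj_by G q m \<noteq> \<one>" using conj_by_eq_one_iff[OF qG mG] m(2) by simp
  ultimately consider "conj_by G q m = m" | "conj_by G q m = inv m" using all by blast
  then have "conj_by G q (conj_by G q m) = m"
    using conj_by_inv[OF qG mG] mG by cases simp_all
  then have "conj_by G z m = m"
    using conj_by_Q_twice[OF q(1) mN] square_eq_z[OF q] by simp
  then have "m = inv m" using m(1) by (simp add: inverted_def)
  then show False using eq_one_if_eq_inv[OF mN] m(2) by blast
qed

lemma divisors_of_nine:
  assumes "(k :: nat) dvd 9"
  shows "k = 1 \<or> k = 3 \<or> k = 9"
proof -
  have "k \<le> 9" using assms by (rule dvd_imp_le) simp
  then have "k \<in> {0, 1, 2, 3, 4, 5, 6, 7, 8, 9}" by auto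
  then show ?thesis using assms by (elim insertE) simp_all
qed

text \<open>
  The order of the subgroup of inverted elements divides 9 and is not 3. It is not 1 either, because
  each n differs from its conjugate by an inverted element, and z would then act trivially on N.
\<close>

lemma z_inverts:
  assumes "n \<in> N"
  shows "conj_by G z n = inv n"
proof -
  have sub: "inverted \<subseteq> N" unfolding inverted_def by blast
  have "subgroup inverted (G\<lparr>carrier := N\<rparr>)"
    using subgroup_incl[OF subgroup_inverted subgroup_N sub] .
  then have "card (rcosets\<^bsub>G\<lparr>carrier := N\<rparr>\<^esub> inverted) * card inverted = 9"
    using group.lagrange[OF subgroup_imp_group[OF subgroup_N]] card_N by (simp add: order_def)
  then have "card inverted dvd 9" by (metis dvd_triv_right)
  then have "card inverted = 1 \<or> card inverted = 3 \<or> card inverted = 9"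
    by (rule divisors_of_nine)
  moreover have "card inverted \<noteq> 1"
  proof
    assume "card inverted = 1"
    then obtain w where "inverted = {w}" by (rule card_1_singletonE)
    then have only_one: "inverted = {\<one>}" using subgroup.one_closed[OF subgroup_inverted] by simp
    have "conj_by G z n = n" if n: "n \<in> N" for n
    proof -
      have m: "conj_by G z n \<in> carrier G" using conj_by_Q_in_N[OF z_in_Q n] N_carrier by blast
      have "n \<otimes> inv (conj_by G z n) = \<one>" using displacement_inverted[OF n] only_one by simp
      then show ?thesis using inv_equality[of n "inv (conj_by G z n)"] m N_carrier[OF n] by simp
    qed
    then have "z = \<one>" using faithful[OF z_in_Q] by blast
    then show False using z_not_one by simp
  qed
  ultimately have "card inverted = card N" using card_inverted_ne_3 card_N by simp
  then have "inverted = N" using card_subset_eq[OF finite_N sub] by simp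
  then show ?thesis using assms unfolding inverted_def by blast
qed

text \<open>
  An element fixed by q is fixed by z, since z is q or the square of q.
\<close>

lemma fixed_point_free:
  assumes "q \<in> Q" "q \<noteq> \<one>" "n \<in> N" "conj_by G q n = n"
  shows "n = \<one>"
proof -
  have "conj_by G z n = n"
  proof (cases "q = z")
    case True
    then show ?thesis using assms(4) by simp
  next
    case False
    then show ?thesis using conj_by_Q_twice[OF assms(1,3)] square_eq_z[OF assms(1,2) False] assms(4)
      by simp
  qed
  then have "n = inv n" using z_inverts[OF assms(3)] by simp
  then show ?thesis using eq_one_if_eq_inv[OF assms(3)] by blast
qed

lemma card_coset_N: "x \<in> carrier G \<Longrightarrow> card (N #> x) = 9"
proof -
  assume x: "x \<in> carrier G"
  obtain f where "bij_betw f N (N #> x)"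
    using card_cosets_equal[OF rcosetsI[OF subgroup.subset[OF subgroup_N] x]
      subgroup.subset[OF subgroup_N]] by blast
  then have "card N = card (N #> x)" by (rule bij_betw_same_card)
  then show ?thesis using card_N by simp
qed

lemma conj_by_N_in_coset:
  assumes n: "n \<in> N" and q: "q \<in> Q"
  shows "conj_by G n q \<in> N #> q"
proof -
  have G: "n \<in> carrier G" "q \<in> carrier G" using n q N_carrier Q_carrier by simp_all
  have "conj_by G n q = (n \<otimes> conj_by G q (inv n)) \<otimes> q"
    using G by (simp add: conj_by_def m_assoc)
  moreover have "n \<otimes> conj_by G q (inv n) \<in> N"
    using N_closed(1)[OF n conj_by_Q_in_N[OF q N_closed(2)[OF n]]] .
  ultimately show ?thesis unfolding r_coset_def by blast
qed

text \<open>
  By the absence of fixed points, conjugating q by the elements of N gives as many different elements as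
  N has; they all lie in the coset Nq, so they exhaust it.
\<close>

lemma coset_subset_conj_class:
  assumes q: "q \<in> Q" "q \<noteq> \<one>"
  shows "N #> q \<subseteq> conj_class q"
proof -
  let ?f = "\<lambda>n. conj_by G n q"
  have qG: "q \<in> carrier G" using q Q_carrier by blast
  have inj: "inj_on ?f N"
  proof (rule inj_onI)
    fix m n assume mn: "m \<in> N" "n \<in> N" and eq: "?f m = ?f n"
    let ?k = "inv n \<otimes> m"
    have G: "m \<in> carrier G" "n \<in> carrier G" "?k \<in> carrier G" using mn N_carrier by simp_all
    \<comment> \<open>An element of N commuting with q is a fixed point of q.\<close>
    have "conj_by G (inv n) (?f m) = conj_by G (inv n) (?f n)" using eq by simp
    then have "conj_by G ?k q = q" using G qG by (simp add: conj_by_conj_by conj_by_one)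
    then have "?k \<otimes> q = q \<otimes> ?k" using conj_by_eq_iff_commute[OF G(3) qG qG] by simp
    then have "conj_by G q ?k = ?k" using conj_by_eq_iff_commute[OF qG G(3) G(3)] by simp
    moreover have "?k \<in> N" using mn N_closed by simp
    ultimately have "?k = \<one>" using fixed_point_free[OF q] by blast
    then have "n \<otimes> ?k = n" using G by simp
    then show "m = n" using G by (simp only: inv_cancel_left)
  qed
  have card: "card (?f ` N) = card (N #> q)"
    using card_image[OF inj] card_N card_coset_N[OF qG] by simp
  have "?f ` N \<subseteq> N #> q" using conj_by_N_in_coset[OF _ q(1)] by (rule image_subsetI)
  moreover have "finite (N #> q)" using card_coset_N[OF qG] by (simp add: card_ge_0_finite)
  ultimately have "?f ` N = N #> q" using card by (intro card_subset_eq)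
  moreover have "?f ` N \<subseteq> conj_class q"
    unfolding conj_class_def using N_carrier by blast
  ultimately show ?thesis by simp
qed

lemma conj_class_N_subset:
  assumes n: "n \<in> N" "n \<noteq> \<one>"
  shows "conj_class n \<subseteq> N - {\<one>}"
proof
  fix x assume "x \<in> conj_class n"
  then obtain g where g: "g \<in> carrier G" "x = conj_by G g n" unfolding conj_class_def by blast
  have "x \<in> N" unfolding g(2) using normal_N g(1) n(1) by (rule conj_by_in_normal)
  moreover have "x \<noteq> \<one>" unfolding g(2) using conj_by_eq_one_iff[OF g(1) N_carrier[OF n(1)]] n(2) by simp
  ultimately show "x \<in> N - {\<one>}" by simp
qed

lemma inj_on_conj_by_Q:
  assumes n: "n \<in> N" "n \<noteq> \<one>"
  shows "inj_on (\<lambda>q. conj_by G q n) Q"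
proof (rule inj_onI)
  let ?f = "\<lambda>q. conj_by G q n"
  fix p q assume pq: "p \<in> Q" "q \<in> Q" and eq: "?f p = ?f q"
  have G: "p \<in> carrier G" "q \<in> carrier G" using pq Q_carrier by simp_all
  have nG: "n \<in> carrier G" using n(1) by (rule N_carrier)
  have "conj_by G (inv q) (?f p) = conj_by G (inv q) (?f q)" using eq by (rule arg_cong)
  then have "conj_by G (inv q \<otimes> p) n = n" using G nG by (simp add: conj_by_conj_by conj_by_one)
  moreover have "inv q \<otimes> p \<in> Q" using pq Q_closed by simp
  ultimately have "inv q \<otimes> p = \<one>" using fixed_point_free[OF _ _ n(1)] n(2) by blast
  then have "q \<otimes> (inv q \<otimes> p) = q" using G by simp
  then show "p = q" using G by (simp only: inv_cancel_left)
qed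

text \<open>
  The eight elements of Q move n to eight different elements of N - {1}, which has just eight elements.
\<close>

lemma conj_class_N:
  assumes n: "n \<in> N" "n \<noteq> \<one>"
  shows "conj_class n = N - {\<one>}"
proof (rule equalityI[OF conj_class_N_subset[OF n]])
  let ?f = "\<lambda>q. conj_by G q n"
  have image: "?f ` Q \<subseteq> conj_class n"
    unfolding conj_class_def using subgroup.subset[OF subgroup_Q] by (rule image_mono)
  have "card (?f ` Q) = 8" using card_image[OF inj_on_conj_by_Q[OF n]] card_Q by (rule trans)
  moreover have "card (N - {\<one>}) = 8"
    using card_Diff_singleton[OF one_mem(1)] card_N by simp
  ultimately have "card (?f ` Q) = card (N - {\<one>})" by (simp only:)
  moreover have "finite (N - {\<one>})" using finite_N by simp
  ultimately have "?f ` Q = N - {\<one>}"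
    using subset_trans[OF image conj_class_N_subset[OF n]] by (intro card_subset_eq)
  then show "N - {\<one>} \<subseteq> conj_class n" using image by (simp only:)
qed

end

context faithful_quaternion_product
begin

definition H :: "'a set" where
  "H = N \<union> (N #> z)"

lemma mem_H_iff: "x \<in> H \<longleftrightarrow> x \<in> N \<or> (\<exists>n\<in>N. x = n \<otimes> z)"
  unfolding H_def r_coset_def by blast

lemma H_intros: "n \<in> N \<Longrightarrow> n \<in> H" "n \<in> N \<Longrightarrow> n \<otimes> z \<in> H"
  using mem_H_iff by blast+

lemma z_move:
  assumes "n \<in> N"
  shows "z \<otimes> n = inv n \<otimes> z"
  using conj_by_eq_iff_commute[OF z_carrier N_carrier[OF assms] N_carrier[OF N_closed(2)[OF assms]]]
    z_inverts[OF assms] by (rule iffD1)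

text \<open>
  Since z inverts N, moving z past an element of N replaces that element by its inverse.
\<close>

lemma subgroup_H: "subgroup H G"
proof (rule subgroupI)
  show "H \<subseteq> carrier G" using mem_H_iff N_carrier z_carrier by blast
  show "H \<noteq> {}" using H_intros(1)[OF one_mem(1)] by blast
next
  fix h assume "h \<in> H"
  then consider "h \<in> N" | n where "n \<in> N" "h = n \<otimes> z" using mem_H_iff by blast
  then show "inv h \<in> H"
  proof cases
    case 1
    then show ?thesis by (intro H_intros(1) N_closed(2))
  next
    case 2
    have nG: "n \<in> carrier G" using 2(1) by (rule N_carrier)
    have "inv z = z" using inv_equality[OF z_square z_carrier z_carrier] .
    then have "inv h = z \<otimes> inv n" unfolding 2(2) using inv_mult_group[OF nG z_carrier] by simp
    also have "\<dots> = n \<otimes> z" using z_move[OF N_closed(2)[OF 2(1)]] nG by simp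
    finally show ?thesis using H_intros(2)[OF 2(1)] by simp
  qed
next
  fix h k assume "h \<in> H" and k: "k \<in> H"
  have N_times: "n \<otimes> k' \<in> H" if n: "n \<in> N" and k': "k' \<in> H" for n k'
  proof -
    from k' consider "k' \<in> N" | m where "m \<in> N" "k' = m \<otimes> z" using mem_H_iff by blast
    then show ?thesis
    proof cases
      case 1
      then show ?thesis using n by (intro H_intros(1) N_closed(1))
    next
      case 2
      have "n \<otimes> k' = (n \<otimes> m) \<otimes> z"
        unfolding 2(2) using m_assoc[OF N_carrier[OF n] N_carrier[OF 2(1)] z_carrier] by (rule sym)
      then show ?thesis using H_intros(2)[OF N_closed(1)[OF n 2(1)]] by simp
    qed
  qed
  have z_times: "z \<otimes> k \<in> H"
  proof -
    from k consider "k \<in> N" | m where "m \<in> N" "k = m \<otimes> z" using mem_H_iff by blast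
    then show ?thesis
    proof cases
      case 1
      then show ?thesis using z_move[OF 1] H_intros(2)[OF N_closed(2)[OF 1]] by simp
    next
      case 2
      have G: "m \<in> carrier G" "inv m \<in> carrier G" using N_carrier[OF 2(1)] by simp_all
      have "z \<otimes> k = (z \<otimes> m) \<otimes> z" unfolding 2(2) using G z_carrier by (simp add: m_assoc)
      also have "\<dots> = inv m" unfolding z_move[OF 2(1)] using G z_carrier by (simp add: m_assoc z_square)
      finally show ?thesis using H_intros(1)[OF N_closed(2)[OF 2(1)]] by simp
    qed
  qed
  have kG: "k \<in> carrier G" using k mem_H_iff N_carrier z_carrier by blast
  from \<open>h \<in> H\<close> consider "h \<in> N" | n where "n \<in> N" "h = n \<otimes> z" using mem_H_iff by blast
  then show "h \<otimes> k \<in> H"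
  proof cases
    case 1
    then show ?thesis using N_times k by blast
  next
    case 2
    have "h \<otimes> k = n \<otimes> (z \<otimes> k)"
      unfolding 2(2) by (rule m_assoc[OF N_carrier[OF 2(1)] z_carrier kG])
    then show ?thesis using N_times[OF 2(1) z_times] by simp
  qed
qed

lemma carrier_eq_product:
  assumes "g \<in> carrier G"
  obtains n q where "n \<in> N" "q \<in> Q" "g = n \<otimes> q"
  using assms unfolding NQ[symmetric] set_mult_def by blast

lemma normal_H: "H \<lhd> G"
  unfolding normal_inv_iff
proof (intro conjI ballI subgroup_H)
  fix g h assume g: "g \<in> carrier G" and "h \<in> H"
  then consider "h \<in> N" | n where "n \<in> N" "h = n \<otimes> z" using mem_H_iff by blast
  then have "conj_by G g h \<in> H"
  proof cases
    case 1
    show ?thesis using conj_by_in_normal[OF normal_N g 1] by (rule H_intros(1))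
  next
    case 2
    obtain m p where mp: "m \<in> N" "p \<in> Q" "g = m \<otimes> p" using carrier_eq_product[OF g] by blast
    have G: "m \<in> carrier G" "p \<in> carrier G" using mp N_carrier Q_carrier by simp_all
    have "conj_by G p z = z"
      using conj_by_eq_iff_commute[OF G(2) z_carrier z_carrier] z_central[OF mp(2)] by simp
    then have "conj_by G g z = conj_by G m z"
      unfolding mp(3) using conj_by_conj_by[OF G z_carrier] by simp
    then have "conj_by G g z \<in> H"
      using conj_by_N_in_coset[OF mp(1) z_in_Q] unfolding H_def by simp
    then have "conj_by G g n \<otimes> conj_by G g z \<in> H"
      using H_intros(1)[OF conj_by_in_normal[OF normal_N g 2(1)]]
      by (intro subgroup.m_closed[OF subgroup_H])
    then show ?thesis
      unfolding 2(2) conj_by_mult[OF g N_carrier[OF 2(1)] z_carrier] .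
  qed
  then show "g \<otimes> h \<otimes> inv g \<in> H" unfolding conj_by_def .
qed

lemma coset_z_eq: "N #> z = H - N"
proof -
  have "n \<otimes> z \<notin> N" if n: "n \<in> N" for n
  proof
    assume "n \<otimes> z \<in> N"
    then have "inv n \<otimes> (n \<otimes> z) \<in> N" using N_closed(1) N_closed(2)[OF n] by blast
    then show False using z_notin_N by (simp add: inv_cancel_left N_carrier[OF n] z_carrier)
  qed
  then have "N \<inter> (N #> z) = {}" unfolding r_coset_def by blast
  then show ?thesis unfolding H_def by blast
qed

lemma conj_class_eq: 
  assumes "x \<in> carrier G" "y \<in> conj_class x"
  shows "conj_class y = conj_class x"
proof -
  have "y \<in> carrier G" using conj_class_subset assms by blast
  then show ?thesis using conj_class_trans conj_class_sym assms by blast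
qed

text \<open>
  The coset Nz is contained in the class of z, and normality of N and H confines the class to H - N.
\<close>

lemma conj_class_layer:
  assumes "x \<in> H" "x \<notin> N"
  shows "conj_class x = H - N"
proof -
  have "x \<in> N #> z" using assms coset_z_eq by simp
  then have "conj_class x = conj_class z"
    using coset_subset_conj_class[OF z_in_Q z_not_one] conj_class_eq[OF z_carrier] by blast
  moreover have "H - N \<subseteq> conj_class z"
    using coset_subset_conj_class[OF z_in_Q z_not_one] coset_z_eq by simp
  moreover have "conj_class x \<subseteq> H - N"
  proof
    fix y assume "y \<in> conj_class x"
    then obtain g where g: "g \<in> carrier G" "y = conj_by G g x" unfolding conj_class_def by blast
    have xG: "x \<in> carrier G" using subgroup.subset[OF subgroup_H] assms(1) by blast
    show "y \<in> H - N"
      unfolding g(2)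
      using conj_by_in_normal[OF normal_H g(1) assms(1)] conj_by_in_normal_iff[OF normal_N g(1) xG] assms(2)
      by simp
  qed
  ultimately show ?thesis by simp
qed

text \<open>
  The conjugates of q under Q are q and zq. Conjugating further by N stays inside the cosets Nq and N(zq),
  and fills each of them; these two make up the coset Hq.
\<close>

lemma conj_class_outer_Q:
  assumes q: "q \<in> Q" "q \<noteq> \<one>" "q \<noteq> z"
  shows "conj_class q = H #> q"
proof
  have qG: "q \<in> carrier G" using q(1) by (rule Q_carrier)
  have zqQ: "z \<otimes> q \<in> Q" using Q_closed(1)[OF z_in_Q q(1)] .
  have coset: "N #> (z \<otimes> q) \<subseteq> H #> q"
  proof
    fix y assume "y \<in> N #> (z \<otimes> q)"
    then obtain n where n: "n \<in> N" "y = n \<otimes> (z \<otimes> q)" unfolding r_coset_def by blast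
    have "y = (n \<otimes> z) \<otimes> q" unfolding n(2) using m_assoc[OF N_carrier[OF n(1)] z_carrier qG] by simp
    then show "y \<in> H #> q" using H_intros(2)[OF n(1)] unfolding r_coset_def by blast
  qed
  have coset': "N #> q \<subseteq> H #> q" using H_intros(1) unfolding r_coset_def by blast
  show "conj_class q \<subseteq> H #> q"
  proof
    fix y assume "y \<in> conj_class q"
    then obtain g where g: "g \<in> carrier G" "y = conj_by G g q" unfolding conj_class_def by blast
    obtain m p where mp: "m \<in> N" "p \<in> Q" "g = m \<otimes> p" using carrier_eq_product[OF g(1)] by blast
    have G: "m \<in> carrier G" "p \<in> carrier G" using mp N_carrier Q_carrier by simp_all
    have y: "y = conj_by G m (conj_by G p q)"
      unfolding g(2) mp(3) using conj_by_conj_by[OF G qG] by simp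
    have "z \<otimes> (q \<otimes> p) = (z \<otimes> q) \<otimes> p" using m_assoc[OF z_carrier qG G(2)] by simp
    then have "p \<otimes> q = q \<otimes> p \<or> p \<otimes> q = (z \<otimes> q) \<otimes> p"
      using commute_up_to_z[OF mp(2) q(1)] by simp
    then have "conj_by G p q = q \<or> conj_by G p q = z \<otimes> q"
      using conj_by_eq_iff_commute[OF G(2) qG qG]
        conj_by_eq_iff_commute[OF G(2) qG Q_carrier[OF zqQ]] by simp
    then show "y \<in> H #> q"
      unfolding y using conj_by_N_in_coset[OF mp(1) q(1)] conj_by_N_in_coset[OF mp(1) zqQ]
        coset coset' by auto
  qed
  have "z \<otimes> q \<noteq> \<one>"
  proof
    assume "z \<otimes> q = \<one>"
    then have "z \<otimes> q = z \<otimes> z" using z_square by simp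
    then show False using q(3) qG z_carrier by simp
  qed
  then have "N #> (z \<otimes> q) \<subseteq> conj_class (z \<otimes> q)" by (rule coset_subset_conj_class[OF zqQ])
  moreover have "z \<otimes> q \<in> conj_class q"
  proof -
    obtain p where p: "p \<in> Q" "p \<otimes> q = z \<otimes> (q \<otimes> p)" using anticommute[OF q] by blast
    have pG: "p \<in> carrier G" using p(1) by (rule Q_carrier)
    have "p \<otimes> q = (z \<otimes> q) \<otimes> p" using p(2) m_assoc[OF z_carrier qG pG] by simp
    then have "conj_by G p q = z \<otimes> q"
      using conj_by_eq_iff_commute[OF pG qG Q_carrier[OF zqQ]] by simp
    then show ?thesis unfolding conj_class_def using pG by (metis image_eqI)
  qed
  ultimately have "N #> (z \<otimes> q) \<subseteq> conj_class q" using conj_class_eq[OF qG] by simp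
  moreover have "N #> q \<subseteq> conj_class q" using coset_subset_conj_class[OF q(1,2)] .
  moreover have "H #> q \<subseteq> (N #> q) \<union> (N #> (z \<otimes> q))"
  proof
    fix y assume "y \<in> H #> q"
    then obtain h where h: "h \<in> H" "y = h \<otimes> q" unfolding r_coset_def by blast
    from h(1) consider "h \<in> N" | n where "n \<in> N" "h = n \<otimes> z" using mem_H_iff by blast
    then show "y \<in> (N #> q) \<union> (N #> (z \<otimes> q))"
    proof cases
      case 1
      then show ?thesis using h(2) unfolding r_coset_def by blast
    next
      case 2
      have "y = n \<otimes> (z \<otimes> q)"
        unfolding h(2) 2(2) by (rule m_assoc[OF N_carrier[OF 2(1)] z_carrier qG])
      then show ?thesis using 2(1) unfolding r_coset_def by blast
    qed
  qed
  ultimately show "H #> q \<subseteq> conj_class q" by blast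
qed

lemma conj_class_outer:
  assumes x: "x \<in> carrier G" "x \<notin> H"
  shows "conj_class x = H #> x"
proof -
  obtain n q where nq: "n \<in> N" "q \<in> Q" "x = n \<otimes> q" using carrier_eq_product[OF x(1)] by blast
  have qG: "q \<in> carrier G" using nq(2) by (rule Q_carrier)
  have "q \<noteq> z" using x(2) H_intros(2)[OF nq(1)] nq(3) by auto
  moreover have "q \<noteq> \<one>"
    using x(2) H_intros(1)[OF nq(1)] nq(3) N_carrier[OF nq(1)] by auto
  ultimately have q: "conj_class q = H #> q" using conj_class_outer_Q nq(2) by blast
  have "x \<in> H #> q" using nq(3) H_intros(1)[OF nq(1)] unfolding r_coset_def by blast
  then have "H #> q = H #> x" "x \<in> conj_class q"
    using repr_independence[OF _ qG subgroup_H] q by simp_all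
  then show ?thesis using conj_class_eq[OF qG] q by simp
qed

lemma conj_class_eq_chain_class:
  assumes x: "x \<in> carrier G"
  shows "conj_class x = chain_class G N H x"
proof -
  have "conj_class \<one> = {\<one>}"
    using conj_class_self[OF one_closed] conj_by_eq_one_iff unfolding conj_class_def by auto
  then show ?thesis
    unfolding chain_class_def
    using conj_class_N conj_class_layer conj_class_outer[OF x] by simp
qed

text \<open>
  Since N and Q meet trivially, a product of an element of N and one of Q determines its factors.
\<close>

lemma order_eq: "order G = 72"
proof -
  have "inj_on (\<lambda>(n, q). n \<otimes> q) (N \<times> Q)"
  proof (rule inj_onI, clarify)
    fix n q n' q' assume mem: "n \<in> N" "q \<in> Q" "n' \<in> N" "q' \<in> Q" and eq: "n \<otimes> q = n' \<otimes> q'"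
    have G: "n \<in> carrier G" "q \<in> carrier G" "n' \<in> carrier G" "q' \<in> carrier G"
      using mem N_carrier Q_carrier by simp_all
    have "inv n' \<otimes> (n \<otimes> q) \<otimes> inv q = inv n' \<otimes> (n' \<otimes> q') \<otimes> inv q" using eq by simp
    then have k: "inv n' \<otimes> n = q' \<otimes> inv q" using G by (simp add: m_assoc inv_cancel_left)
    have "inv n' \<otimes> n \<in> N" using N_closed(1)[OF N_closed(2)[OF mem(3)] mem(1)] .
    moreover have "q' \<otimes> inv q \<in> Q" using Q_closed(1)[OF mem(4) Q_closed(2)[OF mem(2)]] .
    ultimately have "inv n' \<otimes> n \<in> N \<inter> Q" using k by simp
    then have "inv n' \<otimes> n = \<one>" unfolding Int_one by simp
    then have "n' \<otimes> (inv n' \<otimes> n) = n'" using G by simp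
    then have "n = n'" using G by (simp add: inv_cancel_left)
    then show "n = n' \<and> q = q'" using eq G by simp
  qed
  then have "card ((\<lambda>(n, q). n \<otimes> q) ` (N \<times> Q)) = card (N \<times> Q)" by (rule card_image)
  moreover have "(\<lambda>(n, q). n \<otimes> q) ` (N \<times> Q) = carrier G"
    unfolding NQ[symmetric] set_mult_def by auto
  ultimately show ?thesis using card_N card_Q by (simp add: order_def card_cartesian_product)
qed

lemma card_rcosets_H: "card (rcosets H) = 4"
proof -
  have "card (N #> z) = 9" using z_carrier by (rule card_coset_N)
  moreover have "N \<inter> (N #> z) = {}" using coset_z_eq by blast
  moreover have "finite (N #> z)" using calculation(1) by (simp add: card_ge_0_finite)
  ultimately have "card H = 18" unfolding H_def using finite_N card_N by (simp add: card_Un_disjoint)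
  then show ?thesis using lagrange[OF subgroup_H] order_eq by simp
qed

sublocale chain: class_chain G N H z
proof (rule class_chain.intro[OF group_axioms class_chain_axioms.intro])
  show "finite (carrier G)" using order_eq order_gt_0_iff_finite by simp
  show "3 \<le> card N" using card_N by simp
  show "orbit G (\<lambda>g. \<lambda>h\<in>carrier G. g \<otimes> h \<otimes> inv g) x = chain_class G N H x" if "x \<in> carrier G" for x
    using that orbit_eq_conj_class conj_class_eq_chain_class by simp
qed (fact normal_N normal_H z_carrier z_notin_N H_def)+

theorem dim_terwilliger_algebra_eq_44: "cmat.dim (terwilliger_algebra G) = 44"
  using chain.dim_terwilliger_algebra card_rcosets_H by simp

end

section \<open>Products with an elementary abelian kernel of order nine\<close>

lemma (in group) elementary_abelian_if_iso:
  assumes N: "subgroup N G" and iso: "G\<lparr>carrier := N\<rparr> \<cong> integer_mod_group 3 \<times>\<times> integer_mod_group 3"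
  shows "card N = 9"
    and "m \<in> N \<Longrightarrow> n \<in> N \<Longrightarrow> m \<otimes> n = n \<otimes> m"
    and "n \<in> N \<Longrightarrow> n \<otimes> n \<otimes> n = \<one>"
proof -
  let ?Z = "integer_mod_group 3 \<times>\<times> integer_mod_group 3"
  obtain h where h: "h \<in> iso (G\<lparr>carrier := N\<rparr>) ?Z"
    using iso unfolding is_iso_def by blast
  have bij: "bij_betw h N (carrier ?Z)" using h unfolding iso_def by simp
  have hom: "h (m \<otimes> n) = h m \<otimes>\<^bsub>?Z\<^esub> h n" if "m \<in> N" "n \<in> N" for m n
    using h that unfolding iso_def hom_def by simp
  have closed: "m \<otimes> n \<in> N" if "m \<in> N" "n \<in> N" for m n
    using subgroup.m_closed[OF N that] .
  have inj: "m = n" if "m \<in> N" "n \<in> N" "h m = h n" for m n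
    using bij that unfolding bij_betw_def inj_on_def by blast
  have one: "\<one> \<in> N" using N by (rule subgroup.one_closed)
  have "h \<in> hom (G\<lparr>carrier := N\<rparr>) ?Z" using h unfolding iso_def by simp
  then have h_one: "h \<one> = (0, 0)"
    using hom_one[OF _ subgroup_imp_group[OF N]] DirProd_group group_integer_mod_group by fastforce
  show "card N = 9"
    using bij_betw_same_card[OF bij] by (simp add: carrier_integer_mod_group card_cartesian_product)
  show "m \<otimes> n = n \<otimes> m" if "m \<in> N" "n \<in> N"
    using that by (intro inj closed) (simp_all add: hom mult_DirProd' add.commute)
  show "n \<otimes> n \<otimes> n = \<one>" if n: "n \<in> N"
  proof (rule inj)
    have "((a + a) mod 3 + a) mod 3 = 0" for a :: int by presburger
    then show "h (n \<otimes> n \<otimes> n) = h \<one>"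
      using n closed by (simp add: hom mult_DirProd' h_one)
  qed (use n closed one in simp_all)
qed

theorem proposition5p2:
  fixes G :: "('g, 'm) monoid_scheme" and N Q :: "'g set"
  assumes "group G"
    and "is_semidirect_product G N Q"
    and "G\<lparr>carrier := N\<rparr> \<cong> integer_mod_group 3 \<times>\<times> integer_mod_group 3"
    and "G\<lparr>carrier := Q\<rparr> \<cong> quaternion_group"
    and "acts_faithfully_by_conjugation G Q N"
  shows "cmat.dim (terwilliger_algebra G) = 44"
proof -
  interpret group G by fact
  have semi: "N \<lhd> G" "subgroup Q G" "N \<inter> Q = {\<one>\<^bsub>G\<^esub>}" "N <#>\<^bsub>G\<^esub> Q = carrier G"
    using assms(2) unfolding is_semidirect_product_def by blast+
  have N: "subgroup N G" using semi(1) by (rule normal_imp_subgroup)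
  obtain z where "quaternion_subgroup G Q z"
    using quaternion_subgroup_if_iso[OF semi(2) assms(4)] by blast
  then interpret quaternion_subgroup G Q z .
  have "faithful_quaternion_product G Q z N"
  proof (rule faithful_quaternion_product.intro[OF quaternion_subgroup_axioms
        faithful_quaternion_product_axioms.intro])
    fix q assume q: "q \<in> Q" and fix_N: "\<And>n. n \<in> N \<Longrightarrow> conj_by G q n = n"
    have "conj_by G \<one>\<^bsub>G\<^esub> n = n" if "n \<in> N" for n
      using conj_by_one subgroup.subset[OF N] that by blast
    then have "(\<lambda>n\<in>N. conj_by G q n) = (\<lambda>n\<in>N. conj_by G \<one>\<^bsub>G\<^esub> n)"
      using fix_N by (intro restrict_ext) simp
    then show "q = \<one>\<^bsub>G\<^esub>"
      using assms(5) q subgroup.one_closed[OF semi(2)]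
      unfolding acts_faithfully_by_conjugation_def conj_by_def inj_on_def by blast
  qed (fact semi elementary_abelian_if_iso[OF N assms(3)])+
  then show ?thesis by (rule faithful_quaternion_product.dim_terwilliger_algebra_eq_44)
qed

end
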